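(* Let $U,W$ be graphons. There is a signed Markov operator $S\colon L_2[0,1]\to L_2[0,1]$ such that $T_U\circ S=S\circ T_W$ if and only if $t(P,U)=t(P,W)$ for every path $P$.
   Context: A graphon is a symmetric measurable $W\colon[0,1]^2\to[0,1]$; it defines the operator $T_W\colon L_2[0,1]\to L_2[0,1]$, $(T_Wf)(x)=\int_{[0,1]}W(x,y)f(y)\,dy$ (real-valued $L_2$ with Lebesgue measure). For a finite simple graph $F$, $t(F,W)=\int_{[0,1]^{V(F)}}\prod_{ij\in E(F)}W(x_i,x_j)\prod_{i\in V(F)}dx_i$; a path is a path graph. A signed Markov operator is a bounded linear operator $S\colon L_2[0,1]\to L_2[0,1]$ with $\|Sf\|_2\le\|f\|_2$ for all $f$, $S(\mathbf{1})=\mathbf{1}$ and $S^*(\mathbf{1})=\mathbf{1}$, where $\mathbf{1}$ is the constant one function and $S^*$ the Hilbert adjoint. *)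

theory Defs
  imports "HOL-Analysis.Analysis"
begin

section \<open>The Hilbert space of square-integrable functions on the unit interval\<close>

abbreviation unit_leb :: "real measure" where
  "unit_leb \<equiv> lebesgue_on {0..1}"

definition square_integrable :: "(real \<Rightarrow> real) \<Rightarrow> bool" where
  "square_integrable f \<longleftrightarrow>
     f \<in> borel_measurable unit_leb \<and> integrable unit_leb (\<lambda>x. (f x)\<^sup>2)"

definition L2_rel :: "(real \<Rightarrow> real) \<Rightarrow> (real \<Rightarrow> real) \<Rightarrow> bool" where
  "L2_rel f g \<longleftrightarrow>
     square_integrable f \<and> square_integrable g \<and> (AE x in unit_leb. f x = g x)"

lemma square_integrableD [measurable_dest]:
  "square_integrable f \<Longrightarrow> f \<in> borel_measurable unit_leb"
  by (simp add: square_integrable_def)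

lemma L2_rel_refl_iff: "L2_rel f f \<longleftrightarrow> square_integrable f"
  by (simp add: L2_rel_def)

lemma part_equivp_L2_rel: "part_equivp L2_rel"
proof (rule part_equivpI)
  have "square_integrable (\<lambda>_. 0)"
    by (simp add: square_integrable_def)
  then show "\<exists>f. L2_rel f f"
    by (auto simp: L2_rel_refl_iff)
  show "symp L2_rel"
    by (rule sympI) (auto simp: L2_rel_def elim: eventually_mono)
  show "transp L2_rel"
  proof (rule transpI)
    fix f g h assume "L2_rel f g" "L2_rel g h"
    moreover from this have "AE x in unit_leb. f x = h x"
      unfolding L2_rel_def by (auto elim: eventually_elim2)
    ultimately show "L2_rel f h"
      by (auto simp: L2_rel_def)
  qed
qed

quotient_type L2 = "real \<Rightarrow> real" / partial: L2_rel
  by (rule part_equivp_L2_rel)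

lemma square_integrable_mult:
  assumes "square_integrable f" "square_integrable g"
  shows "integrable unit_leb (\<lambda>x. f x * g x)"
proof (rule Bochner_Integration.integrable_bound)
  show "integrable unit_leb (\<lambda>x. (f x)\<^sup>2 + (g x)\<^sup>2)"
    using assms by (simp add: square_integrable_def)
  show "(\<lambda>x. f x * g x) \<in> borel_measurable unit_leb"
    using assms by (auto simp: square_integrable_def)
  show "AE x in unit_leb. norm (f x * g x) \<le> norm ((f x)\<^sup>2 + (g x)\<^sup>2)"
  proof (rule AE_I2)
    fix x
    have "0 \<le> (\<bar>f x\<bar> - \<bar>g x\<bar>)\<^sup>2" by simp
    then have "2 * (\<bar>f x\<bar> * \<bar>g x\<bar>) \<le> (f x)\<^sup>2 + (g x)\<^sup>2"
      by (simp add: power2_diff)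
    moreover have "0 \<le> \<bar>f x\<bar> * \<bar>g x\<bar>" by simp
    ultimately have "\<bar>f x\<bar> * \<bar>g x\<bar> \<le> (f x)\<^sup>2 + (g x)\<^sup>2" by linarith
    then show "norm (f x * g x) \<le> norm ((f x)\<^sup>2 + (g x)\<^sup>2)"
      by (simp add: abs_mult)
  qed
qed

lemma square_integrable_add:
  assumes "square_integrable f" "square_integrable g"
  shows "square_integrable (\<lambda>x. f x + g x)"
proof -
  have "integrable unit_leb (\<lambda>x. (f x)\<^sup>2 + (g x)\<^sup>2 + 2 * (f x * g x))"
    using assms square_integrable_mult[OF assms]
    by (intro Bochner_Integration.integrable_add integrable_mult_right)
       (auto simp: square_integrable_def)
  then have "integrable unit_leb (\<lambda>x. (f x + g x)\<^sup>2)"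
    by (simp add: power2_sum mult.assoc)
  moreover have "(\<lambda>x. f x + g x) \<in> borel_measurable unit_leb"
    using assms by (intro borel_measurable_add) (auto simp: square_integrable_def)
  ultimately show ?thesis
    by (simp add: square_integrable_def)
qed

lemma square_integrable_cmult:
  assumes "square_integrable f"
  shows "square_integrable (\<lambda>x. c * f x)"
  using assms by (auto simp: square_integrable_def power_mult_distrib)

lemma square_integrable_const: "square_integrable (\<lambda>_. c)"
  by (simp add: square_integrable_def)

lemma square_integrable_integrable:
  assumes "square_integrable f"
  shows "integrable unit_leb f"
  using square_integrable_mult[OF assms square_integrable_const[of 1]] by simp

instantiation L2 :: real_inner
begin

lift_definition zero_L2 :: L2 is "\<lambda>_. 0"
  by (simp add: L2_rel_refl_iff square_integrable_const)

lift_definition plus_L2 :: "L2 \<Rightarrow> L2 \<Rightarrow> L2" is "\<lambda>f g x. f x + g x"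
  by (auto simp: L2_rel_def square_integrable_add)

lift_definition uminus_L2 :: "L2 \<Rightarrow> L2" is "\<lambda>f x. - f x"
  using square_integrable_cmult[of _ "-1"] by (auto simp: L2_rel_def)

definition minus_L2 :: "L2 \<Rightarrow> L2 \<Rightarrow> L2" where
  "minus_L2 f g = f + (- g)"

lift_definition scaleR_L2 :: "real \<Rightarrow> L2 \<Rightarrow> L2" is "\<lambda>c f x. c * f x"
  by (auto simp: L2_rel_def square_integrable_cmult)

lift_definition inner_L2 :: "L2 \<Rightarrow> L2 \<Rightarrow> real" is
  "\<lambda>f g. integral\<^sup>L unit_leb (\<lambda>x. f x * g x)"
proof -
  fix f f' g g' assume "L2_rel f f'" "L2_rel g g'"
  then show "integral\<^sup>L unit_leb (\<lambda>x. f x * g x) = integral\<^sup>L unit_leb (\<lambda>x. f' x * g' x)"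
    unfolding L2_rel_def
    by (intro integral_cong_AE) (auto simp: square_integrable_def)
qed

definition norm_L2 :: "L2 \<Rightarrow> real" where
  "norm_L2 f = sqrt (inner f f)"

definition sgn_L2 :: "L2 \<Rightarrow> L2" where
  "sgn_L2 f = inverse (norm f) *\<^sub>R f"

definition dist_L2 :: "L2 \<Rightarrow> L2 \<Rightarrow> real" where
  "dist_L2 f g = norm (f - g)"

definition uniformity_L2 :: "(L2 \<times> L2) filter" where
  "uniformity_L2 = (INF e\<in>{0<..}. principal {(x, y). dist x y < e})"

definition open_L2 :: "L2 set \<Rightarrow> bool" where
  "open_L2 U \<longleftrightarrow> (\<forall>x\<in>U. eventually (\<lambda>(x', y). x' = x \<longrightarrow> y \<in> U) uniformity)"

instance
proof
  fix a b c :: L2 and r s :: real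
  show "a + b + c = a + (b + c)"
    by transfer (auto simp: L2_rel_def algebra_simps intro!: square_integrable_add)
  show "a + b = b + a"
    by transfer (auto simp: L2_rel_def algebra_simps intro!: square_integrable_add)
  show "0 + a = a"
    by transfer (auto simp: L2_rel_def)
  show "- a + a = 0"
    by transfer (auto simp: L2_rel_def square_integrable_const)
  show "a - b = a + - b"
    by (rule minus_L2_def)
  show "r *\<^sub>R (a + b) = r *\<^sub>R a + r *\<^sub>R b"
    by transfer
       (auto simp: L2_rel_def distrib_left intro!: square_integrable_add square_integrable_cmult)
  show "(r + s) *\<^sub>R a = r *\<^sub>R a + s *\<^sub>R a"
    by transfer
       (auto simp: L2_rel_def distrib_right intro!: square_integrable_add square_integrable_cmult)
  show "r *\<^sub>R s *\<^sub>R a = (r * s) *\<^sub>R a"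
    by transfer (auto simp: L2_rel_def mult.assoc intro!: square_integrable_cmult)
  show "1 *\<^sub>R a = a"
    by transfer (auto simp: L2_rel_def)
  show "dist a b = norm (a - b)"
    by (rule dist_L2_def)
  show "sgn a = inverse (norm a) *\<^sub>R a"
    by (rule sgn_L2_def)
  show "uniformity = (INF e\<in>{0<..}. principal {(x :: L2, y). dist x y < e})"
    by (rule uniformity_L2_def)
  show "open U \<longleftrightarrow> (\<forall>x\<in>U. eventually (\<lambda>(x', y). x' = x \<longrightarrow> y \<in> U) uniformity)"
    for U :: "L2 set"
    by (rule open_L2_def)
  show "inner a b = inner b a"
    by transfer (simp add: mult.commute)
  show "inner (a + b) c = inner a c + inner b c"
    by transfer
       (simp add: L2_rel_def distrib_right square_integrable_mult Bochner_Integration.integral_add)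
  show "inner (r *\<^sub>R a) b = r * inner a b"
    by transfer (simp add: mult.assoc)
  show "0 \<le> inner a a"
    by transfer simp
  show "inner a a = 0 \<longleftrightarrow> a = 0"
  proof transfer
    fix f assume "L2_rel f f"
    then have f: "square_integrable f" by (simp add: L2_rel_refl_iff)
    have "integral\<^sup>L unit_leb (\<lambda>x. f x * f x) = 0 \<longleftrightarrow> (AE x in unit_leb. f x * f x = 0)"
      using square_integrable_mult[OF f f] by (intro integral_nonneg_eq_0_iff_AE) auto
    then show "(integral\<^sup>L unit_leb (\<lambda>x. f x * f x) = 0) = L2_rel f (\<lambda>_. 0)"
      using f by (simp add: L2_rel_def square_integrable_const)
  qed
  show "norm a = sqrt (inner a a)"
    by (rule norm_L2_def)
qed

end

lift_definition one_L2 :: L2 is "\<lambda>_. 1"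
  by (simp add: L2_rel_refl_iff square_integrable_const)


section \<open>Graphons and their operators\<close>

definition graphon :: "(real \<Rightarrow> real \<Rightarrow> real) \<Rightarrow> bool" where
  "graphon W \<longleftrightarrow>
     (\<lambda>(x, y). W x y) \<in> borel_measurable (lebesgue_on ({0..1} \<times> {0..1})) \<and>
     (\<forall>x\<in>{0..1}. \<forall>y\<in>{0..1}. W x y = W y x) \<and>
     (\<forall>x\<in>{0..1}. \<forall>y\<in>{0..1}. 0 \<le> W x y \<and> W x y \<le> 1)"

lemma lebesgue_integral_cong_AE:
  fixes f g :: "'a::euclidean_space \<Rightarrow> real"
  assumes "AE x in lebesgue. f x = g x"
  shows "integral\<^sup>L lebesgue f = integral\<^sup>L lebesgue g"
proof (cases "f \<in> borel_measurable lebesgue \<or> g \<in> borel_measurable lebesgue")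
  case True
  have "AE x in lebesgue. g x = f x"
    using assms by eventually_elim simp
  then have "f \<in> borel_measurable lebesgue" "g \<in> borel_measurable lebesgue"
    using True assms borel_measurable_AE by blast+
  then show ?thesis
    using assms by (rule integral_cong_AE)
next
  case False
  then have "\<not> integrable lebesgue f" "\<not> integrable lebesgue g"
    by auto
  then show ?thesis
    by (simp add: not_integrable_integral_eq)
qed

definition kernel_fun :: "(real \<Rightarrow> real \<Rightarrow> real) \<Rightarrow> (real \<Rightarrow> real) \<Rightarrow> real \<Rightarrow> real" where
  "kernel_fun W f x = integral\<^sup>L unit_leb (\<lambda>y. W x y * f y)"

text \<open>
  The class of a function under \<open>abs_L2\<close> is meaningful only for square-integrable functions;
  \<open>square_integrable_kernel_fun\<close> and \<open>graphon_op_abs\<close> below show that this is always the case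
  for a graphon, and that the result does not depend on the chosen representative.
\<close>
definition graphon_op :: "(real \<Rightarrow> real \<Rightarrow> real) \<Rightarrow> L2 \<Rightarrow> L2" where
  "graphon_op W f = abs_L2 (kernel_fun W (rep_L2 f))"

lemma graphon_bounds:
  assumes "graphon W" "x \<in> {0..1}" "y \<in> {0..1}"
  shows "\<bar>W x y\<bar> \<le> 1"
  using assms by (auto simp: graphon_def)

lemma square_integrable_kernel_fun:
  assumes W: "graphon W" and f: "square_integrable f"
  shows "square_integrable (kernel_fun W f)"
proof -
  let ?S = "{0..1::real} \<times> {0..1::real}"
  let ?W0 = "\<lambda>z. if z \<in> ?S then (\<lambda>(x, y). W x y) z else 0"
  let ?f0 = "\<lambda>y. if y \<in> {0..1} then f y else 0"
  have "?S \<in> sets lebesgue"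
    by (intro lmeasurable_compact fmeasurableD compact_Times) auto
  then have "?W0 \<in> borel_measurable lebesgue"
    using W by (intro borel_measurable_if_I) (auto simp: graphon_def)
  then obtain W' where W': "W' \<in> borel_measurable lborel" "AE z in lborel. ?W0 z = W' z"
    by (auto dest: completion_ex_borel_measurable_real)
  have "?f0 \<in> borel_measurable lebesgue"
    using f by (intro borel_measurable_if_I) (auto simp: square_integrable_def)
  then obtain f' where f': "f' \<in> borel_measurable lborel" "AE y in lborel. ?f0 y = f' y"
    by (auto dest: completion_ex_borel_measurable_real)
  define g where "g x = integral\<^sup>L lborel (\<lambda>y. W' (x, y) * f' y)" for x
  have [measurable]: "W' \<in> borel_measurable (lborel \<Otimes>\<^sub>M lborel)"
    using W'(1) by (simp add: lborel_prod)
  have [measurable]: "f' \<in> borel_measurable lborel" by (fact f'(1))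
  have g_meas: "g \<in> borel_measurable lborel"
    unfolding g_def by measurable
  have "AE z in lborel \<Otimes>\<^sub>M lborel. ?W0 z = W' z"
    unfolding lborel_prod by (rule W'(2))
  then have sect: "AE x in lborel. AE y in lborel. ?W0 (x, y) = W' (x, y)"
    by (rule lborel_pair.AE_pair)
  have eq: "AE x in lborel. x \<in> {0..1} \<longrightarrow> kernel_fun W f x = g x"
    using sect
  proof eventually_elim
    case (elim x)
    show ?case
    proof
      assume x: "x \<in> {0..1}"
      have ae: "AE y in lborel. ?W0 (x, y) * ?f0 y = W' (x, y) * f' y"
        using elim f'(2) by eventually_elim simp
      have "kernel_fun W f x =
          integral\<^sup>L lebesgue (\<lambda>y. if y \<in> {0..1} then W x y * f y else 0)"
        unfolding kernel_fun_def by (rule Lebesgue_Measure.integral_restrict_UNIV[symmetric]) simp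
      also have "(\<lambda>y. if y \<in> {0..1} then W x y * f y else 0) = (\<lambda>y. ?W0 (x, y) * ?f0 y)"
        using x by auto
      also have "integral\<^sup>L lebesgue (\<lambda>y. ?W0 (x, y) * ?f0 y) =
          integral\<^sup>L lebesgue (\<lambda>y. W' (x, y) * f' y)"
        by (rule lebesgue_integral_cong_AE) (rule AE_completion[OF ae])
      also have "\<dots> = g x"
        unfolding g_def by (rule integral_completion) measurable
      finally show "kernel_fun W f x = g x" .
    qed
  qed
  let ?k0 = "\<lambda>x. if x \<in> {0..1} then kernel_fun W f x else 0"
  have "(\<lambda>x. if x \<in> {0..1} then g x else 0) \<in> borel_measurable lebesgue"
    using g_meas
    by (intro borel_measurable_if_I measurable_restrict_space1 measurable_completion) auto
  moreover have "AE x in lebesgue. (if x \<in> {0..1} then g x else 0) = ?k0 x"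
    by (rule AE_completion) (use eq in eventually_elim, auto)
  ultimately have "?k0 \<in> borel_measurable lebesgue"
    by (rule borel_measurable_AE)
  then have meas: "kernel_fun W f \<in> borel_measurable unit_leb"
    by (rule borel_measurable_if_D)
  define C where "C = integral\<^sup>L unit_leb (\<lambda>y. \<bar>f y\<bar>)"
  have C0: "0 \<le> C"
    by (simp add: C_def)
  have bound: "\<bar>kernel_fun W f x\<bar> \<le> C" if x: "x \<in> {0..1}" for x
  proof (cases "integrable unit_leb (\<lambda>y. W x y * f y)")
    case True
    have "\<bar>kernel_fun W f x\<bar> \<le> integral\<^sup>L unit_leb (\<lambda>y. \<bar>W x y * f y\<bar>)"
      unfolding kernel_fun_def by (rule integral_abs_bound)
    also have "\<dots> \<le> C"
      unfolding C_def
    proof (rule integral_mono)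
      show "integrable unit_leb (\<lambda>y. \<bar>W x y * f y\<bar>)"
        using True by simp
      show "integrable unit_leb (\<lambda>y. \<bar>f y\<bar>)"
        using square_integrable_integrable[OF f] by simp
      fix y assume "y \<in> space unit_leb"
      then have "\<bar>W x y\<bar> \<le> 1"
        using graphon_bounds[OF W x] by simp
      then show "\<bar>W x y * f y\<bar> \<le> \<bar>f y\<bar>"
        by (simp add: abs_mult mult_left_le_one_le)
    qed
    finally show ?thesis .
  next
    case False
    then show ?thesis
      using C0 by (simp add: kernel_fun_def not_integrable_integral_eq)
  qed
  have fin: "finite_measure unit_leb"
    by (rule finite_measureI) (simp add: emeasure_restrict_space)
  have "integrable unit_leb (\<lambda>x. (kernel_fun W f x)\<^sup>2)"
  proof (rule finite_measure.integrable_const_bound[OF fin])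
    show "AE x in unit_leb. norm ((kernel_fun W f x)\<^sup>2) \<le> C\<^sup>2"
      using bound by (intro AE_I2) (simp add: abs_le_square_iff[symmetric] C0)
    show "(\<lambda>x. (kernel_fun W f x)\<^sup>2) \<in> borel_measurable unit_leb"
      using meas by measurable
  qed
  with meas show ?thesis
    by (simp add: square_integrable_def)
qed

lemma kernel_fun_cong_AE:
  assumes "AE y in unit_leb. f y = g y"
  shows "kernel_fun W f x = kernel_fun W g x"
proof -
  have "AE y in lebesgue. y \<in> {0..1} \<longrightarrow> f y = g y"
    using assms by (subst (asm) AE_restrict_space_iff) auto
  then have "AE y in lebesgue.
      (if y \<in> {0..1} then W x y * f y else 0) = (if y \<in> {0..1} then W x y * g y else 0)"
    by eventually_elim auto
  then have "integral\<^sup>L lebesgue (\<lambda>y. if y \<in> {0..1} then W x y * f y else 0) =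
      integral\<^sup>L lebesgue (\<lambda>y. if y \<in> {0..1} then W x y * g y else 0)"
    by (rule lebesgue_integral_cong_AE)
  moreover have "kernel_fun W h x =
      integral\<^sup>L lebesgue (\<lambda>y. if y \<in> {0..1} then W x y * h y else 0)" for h
    unfolding kernel_fun_def by (rule Lebesgue_Measure.integral_restrict_UNIV[symmetric]) simp
  ultimately show ?thesis
    by simp
qed

lemma graphon_op_abs:
  assumes W: "graphon W" and f: "square_integrable f"
  shows "graphon_op W (abs_L2 f) = abs_L2 (kernel_fun W f)"
proof -
  have "L2_rel (rep_L2 (abs_L2 f)) f"
    using f Quotient3_L2 by (simp add: L2_rel_refl_iff rep_abs_rsp_left)
  then have "kernel_fun W (rep_L2 (abs_L2 f)) = kernel_fun W f"
    by (intro ext kernel_fun_cong_AE) (simp add: L2_rel_def)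
  then show ?thesis
    by (simp add: graphon_op_def)
qed


section \<open>Signed Markov operators\<close>

text \<open>
  \<open>L2\<close> is complete and \<open>S\<close> is bounded, so by the Riesz representation theorem the choice in
  the library's \<open>adjoint\<close> picks out the unique Hilbert adjoint.
\<close>
definition signed_markov :: "(L2 \<Rightarrow> L2) \<Rightarrow> bool" where
  "signed_markov S \<longleftrightarrow>
     bounded_linear S \<and> (\<forall>f. norm (S f) \<le> norm f) \<and>
     S one_L2 = one_L2 \<and> adjoint S one_L2 = one_L2"


section \<open>Homomorphism densities\<close>

text \<open>A graph is a pair of a vertex set and a set of two-element sets of vertices.\<close>

type_synonym 'a graph = "'a set \<times> 'a set set"

definition finite_simple_graph :: "'a graph \<Rightarrow> bool" where
  "finite_simple_graph F \<longleftrightarrow>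
     finite (fst F) \<and> (\<forall>e\<in>snd F. e \<subseteq> fst F \<and> card e = 2)"

text \<open>The value \<open>W (x i) (x j)\<close> at an unordered pair \<open>e = {i, j}\<close>; see \<open>edge_value_eq\<close>.\<close>

definition edge_value :: "(real \<Rightarrow> real \<Rightarrow> real) \<Rightarrow> ('a \<Rightarrow> real) \<Rightarrow> 'a set \<Rightarrow> real" where
  "edge_value W x e = (THE w. \<exists>i j. e = {i, j} \<and> w = W (x i) (x j))"

lemma edge_value_eq:
  assumes "graphon W" "x i \<in> {0..1}" "x j \<in> {0..1}"
  shows "edge_value W x {i, j} = W (x i) (x j)"
  unfolding edge_value_def
  using assms by (intro the_equality) (auto simp: graphon_def doubleton_eq_iff)

text \<open>
  The completed product is Lebesgue measure on the cube. The completion matters: a Lebesgue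
  measurable graphon need not be measurable for the product sigma-algebra.
\<close>
definition hom_density :: "'a graph \<Rightarrow> (real \<Rightarrow> real \<Rightarrow> real) \<Rightarrow> real" where
  "hom_density F W =
     integral\<^sup>L (completion (Pi\<^sub>M (fst F) (\<lambda>_. restrict_space lborel {0..1})))
       (\<lambda>x. \<Prod>e\<in>snd F. edge_value W x e)"

definition path_graph :: "'a list \<Rightarrow> 'a graph" where
  "path_graph vs = (set vs, {{vs ! i, vs ! Suc i} | i. Suc i < length vs})"

definition is_path :: "'a graph \<Rightarrow> bool" where
  "is_path P \<longleftrightarrow> (\<exists>vs. vs \<noteq> [] \<and> distinct vs \<and> P = path_graph vs)"

lemma is_path_simple:
  assumes "is_path P"
  shows "finite_simple_graph P"
proof -
  obtain vs where vs: "distinct vs" "P = path_graph vs"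
    using assms by (auto simp: is_path_def)
  then have "card {vs ! i, vs ! Suc i} = 2" if "Suc i < length vs" for i
    using that by (simp add: nth_eq_iff_index_eq)
  with vs show ?thesis
    by (auto simp: finite_simple_graph_def path_graph_def)
qed

end

theory Submission
  imports Defs "HOL-Probability.Infinite_Product_Measure"
begin

text \<open>
  For a path \<open>P\<close> with \<open>n\<close> edges, \<open>t(P,W) = \<langle>T\<^sub>W\<^sup>n 1, 1\<rangle>\<close>. If \<open>T\<^sub>U S = S T\<^sub>W\<close>, then \<open>T\<^sub>U\<^sup>n 1 = S T\<^sub>W\<^sup>n 1\<close>,
  and pairing with \<open>1 = S 1\<close> gives equal path densities, because a contraction preserves inner products
  with a vector whose norm it preserves. Conversely, since the operators are self-adjoint, equal path
  densities say that the sequences \<open>T\<^sub>U\<^sup>n 1\<close> and \<open>T\<^sub>W\<^sup>n 1\<close> have the same Gram matrix. Gram--Schmidt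
  orthonormalisation then uses the same coefficients for both, giving \<open>q\<^sub>i\<close> from \<open>T\<^sub>W\<^sup>n 1\<close> and \<open>r\<^sub>i\<close>
  from \<open>T\<^sub>U\<^sup>n 1\<close>, and \<open>S f = (\<Sum>i. \<langle>q\<^sub>i, f\<rangle> r\<^sub>i)\<close> is a partial isometry that maps \<open>T\<^sub>W\<^sup>n 1\<close> to \<open>T\<^sub>U\<^sup>n 1\<close>,
  intertwines the operators, and has as adjoint the same map with the two sequences exchanged.
\<close>

section \<open>Intertwining self-adjoint operators on a Hilbert space\<close>

text \<open>The quadratic polynomial \<open>|u + t f|^2 - |S (u + t f)|^2\<close> in
  \<open>t\<close> is nonnegative and vanishes at \<open>t = 0\<close>, so its linear coefficient
  must vanish.\<close>

lemma contraction_inner: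
  fixes S :: "'a::real_inner \<Rightarrow> 'b::real_inner"
  assumes "linear S" and le: "\<And>f. norm (S f) \<le> norm f" and u: "norm (S u) = norm u"
  shows "inner (S f) (S u) = inner f u"
proof -
  interpret linear S by fact
  define d where "d = inner (S f) (S u) - inner f u"
  define c where "c = inner f f - inner (S f) (S f)"
  have sq: "inner (S g) (S g) \<le> inner g g" for g
    using le[of g] by (simp add: norm_eq_sqrt_inner)
  have c: "c \<ge> 0"
    unfolding c_def using sq[of f] by simp
  have "inner (S u) (S u) = inner u u"
    using u by (simp add: norm_eq_sqrt_inner)
  then have key: "2 * t * d \<le> t * t * c" for t
    using sq[of "u + t *\<^sub>R f"] unfolding d_def c_def
    by (simp add: add scale inner_add inner_commute algebra_simps)
  \<comment> \<open>Any small multiple of \<open>d\<close> would do. Adding 1 keeps the denominator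
    positive when \<open>c = 0\<close>, and the inequality becomes
    \<open>2 t^2 (c + 1) \<le> t^2 c\<close>, which forces \<open>t = 0\<close>.\<close>
  define t where "t = d / (c + 1)"
  have d: "d = t * (c + 1)"
    unfolding t_def using c by (simp add: field_simps)
  have "2 * (t * t) * (c + 1) \<le> t * t * c"
    using key[of t] unfolding d by (simp add: algebra_simps)
  moreover have "t * t * c \<ge> 0"
    using c by simp
  ultimately have "t * t \<le> 0"
    by (simp add: algebra_simps)
  then have "t = 0"
    by (simp add: mult_le_0_iff) linarith
  with d show ?thesis
    unfolding d_def by simp
qed

section \<open>Gram-Schmidt orthonormalisation and its dependence on the Gram matrix\<close>

fun gram_schmidt :: "(nat \<Rightarrow> 'a::real_inner) \<Rightarrow> nat \<Rightarrow> 'a" where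
  "gram_schmidt a n =
     sgn (a n - (\<Sum>i<n. inner (gram_schmidt a i) (a n) *\<^sub>R gram_schmidt a i))"

declare gram_schmidt.simps [simp del]

definition gs_residual :: "(nat \<Rightarrow> 'a::real_inner) \<Rightarrow> nat \<Rightarrow> 'a" where
  "gs_residual a n = a n - (\<Sum>i<n. inner (gram_schmidt a i) (a n) *\<^sub>R gram_schmidt a i)"

lemma gram_schmidt_eq: "gram_schmidt a n = sgn (gs_residual a n)"
  by (simp add: gs_residual_def gram_schmidt.simps[of a n])

lemma inner_gram_schmidt_self:
  "inner (gram_schmidt a n) (gram_schmidt a n) = (if gram_schmidt a n = 0 then 0 else 1)"
  unfolding gram_schmidt_eq dot_square_norm by (simp add: norm_sgn sgn_zero_iff)

lemma gram_schmidt_orthogonal_less: "i < n \<Longrightarrow> inner (gram_schmidt a i) (gram_schmidt a n) = 0"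
proof (induction n arbitrary: i rule: less_induct)
  case (less n)
  \<comment> \<open>The induction hypothesis is applied at the larger of \<open>i\<close> and
    \<open>j\<close>, which is below \<open>n\<close>.\<close>
  have orth: "inner (gram_schmidt a i) (gram_schmidt a j) = 0" if "j < n" "j \<noteq> i" for j
    using that less.IH[of j i] less.IH[of i j] less.prems
    by (metis inner_commute linorder_neqE_nat)
  let ?q = "gram_schmidt a"
  have "inner (?q i) (\<Sum>j<n. inner (?q j) (a n) *\<^sub>R ?q j) =
      (\<Sum>j<n. inner (?q j) (a n) * inner (?q i) (?q j))"
    by (simp add: inner_sum_right)
  also have "\<dots> = (\<Sum>j<n. if j = i then inner (?q i) (a n) * inner (?q i) (?q i) else 0)"
    by (rule sum.cong) (auto simp: orth)
  also have "\<dots> = inner (?q i) (a n) * inner (?q i) (?q i)"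
    using less.prems by simp
  \<comment> \<open>If \<open>?q i\<close> is not a unit vector it is zero, and then both sides
    vanish.\<close>
  also have "\<dots> = inner (?q i) (a n)"
    by (auto simp: inner_gram_schmidt_self)
  finally show ?case
    by (simp add: gram_schmidt_eq[of a n] sgn_div_norm gs_residual_def inner_diff_right)
qed

lemma gram_schmidt_orthogonal: "i \<noteq> j \<Longrightarrow> inner (gram_schmidt a i) (gram_schmidt a j) = 0"
  by (metis gram_schmidt_orthogonal_less inner_commute linorder_neqE_nat)

lemma gram_schmidt_in_span: "gram_schmidt a n \<in> span (range a)"
proof (induction n rule: less_induct)
  case (less n)
  then have "gs_residual a n \<in> span (range a)"
    unfolding gs_residual_def
    by (intro span_diff span_sum span_scale) (auto intro: span_base)
  then show ?case
    by (simp add: gram_schmidt_eq sgn_div_norm span_scale)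
qed

lemma gs_residual_scale: "gs_residual a n = norm (gs_residual a n) *\<^sub>R gram_schmidt a n"
  by (cases "gs_residual a n = 0") (simp_all add: gram_schmidt_eq sgn_div_norm)

lemma inner_gs_residual_less:
  assumes "i < n"
  shows "inner (gs_residual a n) (gram_schmidt a i) = 0"
  using assms by (subst gs_residual_scale) (simp add: gram_schmidt_orthogonal)

lemma inner_gs_residual:
  "inner (gs_residual a n) x =
     inner (a n) x - (\<Sum>i<n. inner (gram_schmidt a i) (a n) * inner (gram_schmidt a i) x)"
  by (simp add: gs_residual_def inner_diff_left inner_sum_left)

text \<open>The difference \<open>a n - gs_residual a n\<close> is a combination of earlier entries,
  all orthogonal to the residual. The norm of the residual thus becomes an expression in inner
  products with \<open>a n\<close>.\<close>

lemma inner_gs_residual_self: "inner (gs_residual a n) (gs_residual a n) = inner (gs_residual a n) (a n)"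
proof -
  have "inner (gs_residual a n) (a n - gs_residual a n) = 0"
    \<comment> \<open>The instance through \<open>arg_cong\<close> unfolds the residual only where
      it is subtracted from \<open>a n\<close>; the left argument stays folded for
      \<open>inner_gs_residual_less\<close>.\<close>
    by (simp add: gs_residual_def[of a n, THEN arg_cong[where f = "\<lambda>r. a n - r"]]
        inner_sum_right inner_gs_residual_less)
  then show ?thesis
    by (simp add: inner_diff_right)
qed

text \<open>The top coefficient equals the norm of the residual, so the top summand is the residual
  itself, also when it is zero.\<close>

lemma gram_schmidt_expansion:
  "a n = (\<Sum>i\<le>n. inner (gram_schmidt a i) (a n) *\<^sub>R gram_schmidt a i)"
proof -
  have "inner (gram_schmidt a n) (a n) = norm (gs_residual a n)"
    using inner_gs_residual_self[of a n, symmetric]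
    by (cases "gs_residual a n = 0")
       (simp_all add: gram_schmidt_eq sgn_div_norm dot_square_norm power2_eq_square)
  then have "inner (gram_schmidt a n) (a n) *\<^sub>R gram_schmidt a n = gs_residual a n"
    using gs_residual_scale[of a n] by simp
  then show ?thesis
    by (simp add: gs_residual_def flip: lessThan_Suc_atMost)
qed

text \<open>By strong induction on \<open>i\<close>, for all \<open>n\<close> at once: inner
  products with the residual at \<open>i\<close>, and hence its norm, are computed from the Gram
  matrix and coefficients of smaller index. Both sequences are therefore normalised by the same
  number. The second conjunct records that zero entries occur at the same places.\<close>

lemma gram_schmidt_gram:
  assumes gram: "\<And>i j. inner (a i) (a j) = inner (b i) (b j)"
  shows "inner (gram_schmidt a i) (a n) = inner (gram_schmidt b i) (b n) \<and>
    (gram_schmidt a i = 0 \<longleftrightarrow> gram_schmidt b i = 0)"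
proof (induction i arbitrary: n rule: less_induct)
  case (less i)
  have r: "inner (gs_residual a i) (a n) = inner (gs_residual b i) (b n)" for n
    unfolding inner_gs_residual using less.IH by (simp add: gram)
  then have "inner (gs_residual a i) (gs_residual a i) = inner (gs_residual b i) (gs_residual b i)"
    by (simp add: inner_gs_residual_self)
  then have "norm (gs_residual a i) = norm (gs_residual b i)"
    by (simp add: norm_eq_sqrt_inner)
  then show ?case
    using r by (simp add: gram_schmidt_eq sgn_div_norm) (metis norm_eq_zero)
qed

section \<open>Bessel's inequality and orthogonal series\<close>

text \<open>Entries of norm below one, in particular zero, are allowed: \<open>gram_schmidt\<close> returns
  zero on linearly dependent inputs.\<close>
definition orthonormal_or_zero :: "(nat \<Rightarrow> 'a::real_inner) \<Rightarrow> bool" where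
  "orthonormal_or_zero q \<longleftrightarrow>
     (\<forall>i j. i \<noteq> j \<longrightarrow> inner (q i) (q j) = 0) \<and> (\<forall>i. inner (q i) (q i) \<le> 1)"

lemma orthonormal_or_zero_gram_schmidt: "orthonormal_or_zero (gram_schmidt a)"
  by (simp add: orthonormal_or_zero_def gram_schmidt_orthogonal inner_gram_schmidt_self)

lemma norm_sum_orthonormal_le:
  assumes q: "orthonormal_or_zero q" and I: "finite I"
  shows "(norm (\<Sum>i\<in>I. c i *\<^sub>R q i))\<^sup>2 \<le> (\<Sum>i\<in>I. (c i)\<^sup>2)"
proof -
  have "(norm (\<Sum>i\<in>I. c i *\<^sub>R q i))\<^sup>2 = (\<Sum>i\<in>I. (norm (c i *\<^sub>R q i))\<^sup>2)"
    using q by (intro norm_sum_Pythagorean[OF I])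
      (auto simp: pairwise_def orthogonal_def orthonormal_or_zero_def)
  also have "\<dots> \<le> (\<Sum>i\<in>I. (c i)\<^sup>2)"
    using q by (intro sum_mono)
      (auto simp: power_mult_distrib orthonormal_or_zero_def mult_left_le simp flip: dot_square_norm)
  finally show ?thesis .
qed

text \<open>Expand \<open>0 \<le> |f - p|^2\<close> for the combination \<open>p\<close>. Since
  entries may be shorter than unit vectors, \<open>|p|^2\<close> is only bounded by the sum of
  squares, which suffices.\<close>

lemma bessel_inequality:
  assumes q: "orthonormal_or_zero q" and I: "finite I"
  shows "(\<Sum>i\<in>I. (inner (q i) f)\<^sup>2) \<le> (norm f)\<^sup>2"
proof -
  define p where "p = (\<Sum>i\<in>I. inner (q i) f *\<^sub>R q i)"
  have "inner p f = (\<Sum>i\<in>I. (inner (q i) f)\<^sup>2)"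
    by (simp add: p_def inner_sum_left power2_eq_square)
  moreover have "inner p p \<le> (\<Sum>i\<in>I. (inner (q i) f)\<^sup>2)"
    unfolding dot_square_norm p_def by (rule norm_sum_orthonormal_le[OF q I])
  moreover have "0 \<le> inner (f - p) (f - p)"
    by simp
  ultimately show ?thesis
    by (simp add: inner_diff inner_commute flip: dot_square_norm)
qed

lemma summable_orthonormal:
  fixes q :: "nat \<Rightarrow> 'a::{real_inner, banach}"
  assumes q: "orthonormal_or_zero q" and c: "summable (\<lambda>i. (c i)\<^sup>2)"
  shows "summable (\<lambda>i. c i *\<^sub>R q i)"
  unfolding summable_Cauchy
proof (intro allI impI)
  fix e :: real assume e: "e > 0"
  \<comment> \<open>The threshold is \<open>e\<^sup>2\<close> because a block of the vector series
    is controlled through its squared norm.\<close>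
  then obtain N where N: "\<And>m n. m \<ge> N \<Longrightarrow> norm (\<Sum>i=m..<n. (c i)\<^sup>2) < e\<^sup>2"
    using c[unfolded summable_Cauchy] by (metis zero_less_power)
  have "norm (\<Sum>i=m..<n. c i *\<^sub>R q i) < e" if "m \<ge> N" for m n
  proof (rule power_less_imp_less_base)
    show "(norm (\<Sum>i=m..<n. c i *\<^sub>R q i))\<^sup>2 < e\<^sup>2"
      using norm_sum_orthonormal_le[OF q, of "{m..<n}" c] N[OF that, of n] by force
    show "0 \<le> e" using e by simp
  qed
  then show "\<exists>N. \<forall>m\<ge>N. \<forall>n. norm (\<Sum>i=m..<n. c i *\<^sub>R q i) < e"
    by blast
qed

section \<open>The partial isometry between two orthonormalised sequences\<close>

definition transfer_op :: "(nat \<Rightarrow> 'a::real_inner) \<Rightarrow> (nat \<Rightarrow> 'b::real_inner) \<Rightarrow> 'a \<Rightarrow> 'b" where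
  "transfer_op a b f = (\<Sum>i. inner (gram_schmidt a i) f *\<^sub>R gram_schmidt b i)"

lemma transfer_op_sums:
  fixes b :: "nat \<Rightarrow> 'b::{real_inner, banach}"
  shows "(\<lambda>i. inner (gram_schmidt a i) f *\<^sub>R gram_schmidt b i) sums transfer_op a b f"
proof -
  have "summable (\<lambda>i. (inner (gram_schmidt a i) f)\<^sup>2)"
    by (rule bounded_imp_summable[where B = "(norm f)\<^sup>2"])
       (auto intro: bessel_inequality orthonormal_or_zero_gram_schmidt)
  then show ?thesis
    unfolding transfer_op_def
    by (intro summable_sums summable_orthonormal orthonormal_or_zero_gram_schmidt)
qed

lemma norm_transfer_op_le:
  fixes b :: "nat \<Rightarrow> 'b::{real_inner, banach}"
  shows "norm (transfer_op a b f) \<le> norm f"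
proof (rule LIMSEQ_le_const2)
  show "(\<lambda>n. norm (\<Sum>i<n. inner (gram_schmidt a i) f *\<^sub>R gram_schmidt b i)) \<longlonglongrightarrow>
      norm (transfer_op a b f)"
    using transfer_op_sums[of a f b] unfolding sums_def by (rule tendsto_norm)
  have "norm (\<Sum>i<n. inner (gram_schmidt a i) f *\<^sub>R gram_schmidt b i) \<le> norm f" for n
  proof (rule power2_le_imp_le)
    show "(norm (\<Sum>i<n. inner (gram_schmidt a i) f *\<^sub>R gram_schmidt b i))\<^sup>2 \<le> (norm f)\<^sup>2"
      by (rule order_trans[OF norm_sum_orthonormal_le bessel_inequality])
         (simp_all add: orthonormal_or_zero_gram_schmidt)
  qed simp
  then show "\<exists>N. \<forall>n\<ge>N. norm (\<Sum>i<n. inner (gram_schmidt a i) f *\<^sub>R gram_schmidt b i) \<le> norm f"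
    by blast
qed

lemma bounded_linear_transfer_op:
  fixes b :: "nat \<Rightarrow> 'b::{real_inner, banach}"
  shows "bounded_linear (transfer_op a b)"
proof (rule bounded_linear_intro[where K = 1])
  fix f g :: 'a and r :: real
  show "transfer_op a b (f + g) = transfer_op a b f + transfer_op a b g"
    using sums_add[OF transfer_op_sums[of a f b] transfer_op_sums[of a g b]]
    by (intro sums_unique2[OF transfer_op_sums]) (simp add: inner_add_right scaleR_left_distrib)
  show "transfer_op a b (r *\<^sub>R f) = r *\<^sub>R transfer_op a b f"
    using sums_scaleR_right[OF transfer_op_sums[of a f b], of r]
    by (intro sums_unique2[OF transfer_op_sums]) simp
  show "norm (transfer_op a b f) \<le> norm f * 1"
    by (simp add: norm_transfer_op_le)
qed

text \<open>Both sides are sums of the same real series, in which the two sequences play symmetric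
  parts.\<close>

lemma inner_transfer_op:
  fixes a :: "nat \<Rightarrow> 'a::{real_inner, banach}" and b :: "nat \<Rightarrow> 'b::{real_inner, banach}"
  shows "inner (transfer_op a b f) g = inner f (transfer_op b a g)"
proof (rule sums_unique2)
  show "(\<lambda>i. inner (gram_schmidt a i) f * inner (gram_schmidt b i) g) sums inner (transfer_op a b f) g"
    using bounded_linear.sums[OF bounded_linear_inner_left transfer_op_sums[of a f b], of g] by simp
  show "(\<lambda>i. inner (gram_schmidt a i) f * inner (gram_schmidt b i) g) sums inner f (transfer_op b a g)"
    using bounded_linear.sums[OF bounded_linear_inner_right transfer_op_sums[of b g a], of f]
    by (simp add: inner_commute mult.commute)
qed

lemma transfer_op_in_closure:
  fixes b :: "nat \<Rightarrow> 'b::{real_inner, banach}"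
  shows "transfer_op a b f \<in> closure (span (range b))"
  unfolding closure_sequential
  using transfer_op_sums[of a f b, unfolded sums_def]
  by (intro exI[of _ "\<lambda>n. \<Sum>i<n. inner (gram_schmidt a i) f *\<^sub>R gram_schmidt b i"])
     (auto intro!: span_sum span_scale gram_schmidt_in_span)

lemma transfer_op_apply:
  fixes a :: "nat \<Rightarrow> 'a::{real_inner, banach}" and b :: "nat \<Rightarrow> 'b::{real_inner, banach}"
  assumes gram: "\<And>i j. inner (a i) (a j) = inner (b i) (b j)"
  shows "transfer_op a b (a n) = b n"
proof -
  interpret S: bounded_linear "transfer_op a b"
    by (rule bounded_linear_transfer_op)
  have q: "transfer_op a b (gram_schmidt a i) = gram_schmidt b i" for i
  proof -
    \<comment> \<open>At \<open>j = i\<close> the coefficient is 1 or 0. In the second case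
      \<open>gram_schmidt a i\<close> is zero, and by the equality of Gram matrices so is
      \<open>gram_schmidt b i\<close>.\<close>
    have "(\<lambda>j. inner (gram_schmidt a j) (gram_schmidt a i) *\<^sub>R gram_schmidt b j) =
        (\<lambda>j. if j = i then gram_schmidt b i else 0)"
      using gram_schmidt_gram[of a b i i, OF gram]
      by (auto simp: gram_schmidt_orthogonal inner_gram_schmidt_self)
    then have "(\<lambda>j. if j = i then gram_schmidt b i else 0) sums transfer_op a b (gram_schmidt a i)"
      using transfer_op_sums[of a "gram_schmidt a i" b] by simp
    then show ?thesis
      using sums_single[of i "\<lambda>_. gram_schmidt b i"] sums_unique2 by blast
  qed
  have "transfer_op a b (a n) =
      (\<Sum>i\<le>n. inner (gram_schmidt a i) (a n) *\<^sub>R transfer_op a b (gram_schmidt a i))"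
    by (subst (2) gram_schmidt_expansion) (simp add: S.sum S.scaleR)
  also have "\<dots> = (\<Sum>i\<le>n. inner (gram_schmidt b i) (b n) *\<^sub>R gram_schmidt b i)"
    using gram_schmidt_gram[of a b, OF gram] by (simp add: q)
  also have "\<dots> = b n"
    by (rule gram_schmidt_expansion[symmetric])
  finally show ?thesis .
qed

section \<open>Closed spans, self-adjoint powers and the intertwiner\<close>

lemma closure_span_invariant:
  fixes B :: "'b::real_normed_vector \<Rightarrow> 'b"
  assumes B: "bounded_linear B" and inv: "\<And>n. B (b n) \<in> span (range b)"
    and x: "x \<in> closure (span (range b))"
  shows "B x \<in> closure (span (range b))"
proof -
  interpret bounded_linear B by fact
  have "B ` span (range b) = span (B ` range b)"
    by (rule linear_span_image[OF linear, symmetric])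
  also have "\<dots> \<subseteq> span (range b)"
    using inv by (intro span_minimal) auto
  finally have "B ` closure (span (range b)) \<subseteq> closure (span (range b))"
    by (intro image_closure_subset) (auto intro: linear_continuous_on B closure_subset[THEN subsetD])
  with x show ?thesis by blast
qed

lemma closure_span_diff:
  fixes X :: "'b::real_normed_vector set"
  assumes "x \<in> closure (span X)" "y \<in> closure (span X)"
  shows "x - y \<in> closure (span X)"
proof -
  obtain f g where "\<And>n. f n \<in> span X" "f \<longlonglongrightarrow> x" "\<And>n. g n \<in> span X" "g \<longlonglongrightarrow> y"
    using assms unfolding closure_sequential by blast
  then show ?thesis
    unfolding closure_sequential
    by (intro exI[of _ "\<lambda>n. f n - g n"]) (auto intro: span_diff tendsto_diff)
qed

text \<open>The hyperplane orthogonal to \<open>x\<close> is a closed subspace containing every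
  \<open>b n\<close>, hence it contains \<open>x\<close> itself.\<close>

lemma orthogonal_closure_span:
  fixes b :: "nat \<Rightarrow> 'b::real_inner"
  assumes orth: "\<And>n. inner x (b n) = 0" and x: "x \<in> closure (span (range b))"
  shows "x = 0"
proof -
  have "span (range b) \<subseteq> {y. inner x y = 0}"
    by (intro span_minimal) (auto simp: orth subspace_hyperplane)
  then have "closure (span (range b)) \<subseteq> {y. inner x y = 0}"
    by (intro closure_minimal closed_hyperplane)
  with x show ?thesis by auto
qed

lemma self_adjoint_funpow:
  assumes "\<And>x y. inner (A x) y = inner x (A y)"
  shows "inner ((A ^^ n) x) y = inner x ((A ^^ n) y)"
proof (induction n arbitrary: y)
  case (Suc n)
  then show ?case
    using assms[of "(A ^^ n) x" y] by (simp add: funpow_swap1[of A n y])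
qed simp

text \<open>The Gram matrix of the iterates depends only on \<open>i + j\<close>, so it is
  determined by the moments.\<close>

lemma self_adjoint_funpow_gram:
  assumes "\<And>x y. inner (A x) y = inner x (A y)"
  shows "inner ((A ^^ i) u) ((A ^^ j) u) = inner ((A ^^ (i + j)) u) u"
proof -
  have "inner ((A ^^ i) u) ((A ^^ j) u) = inner u ((A ^^ (i + j)) u)"
    by (simp add: self_adjoint_funpow[OF assms] funpow_add)
  then show ?thesis
    by (simp add: inner_commute)
qed

text \<open>The defect \<open>B (S f) - S (A f)\<close> lies in the closed span of the vectors
  \<open>b n\<close>, which \<open>B\<close> leaves invariant, and is orthogonal to all of them, so
  it is zero.\<close>

theorem hilbert_intertwiner:
  fixes A :: "'a::{real_inner, banach} \<Rightarrow> 'a" and B :: "'b::{real_inner, banach} \<Rightarrow> 'b"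
  assumes A: "\<And>x y. inner (A x) y = inner x (A y)"
    and B: "\<And>x y. inner (B x) y = inner x (B y)" "bounded_linear B"
    and moments: "\<And>n. inner ((A ^^ n) u) u = inner ((B ^^ n) v) v"
  obtains S where "bounded_linear S" "\<And>f. norm (S f) \<le> norm f" "S u = v" "adjoint S v = u"
    "B \<circ> S = S \<circ> A"
proof
  define a where "a n = (A ^^ n) u" for n
  define b where "b n = (B ^^ n) v" for n
  define S where "S = transfer_op a b"
  have gram: "inner (a i) (a j) = inner (b i) (b j)" for i j
    unfolding a_def b_def self_adjoint_funpow_gram[OF A] self_adjoint_funpow_gram[OF B(1)]
    by (rule moments)
  have adj: "inner (S f) (b n) = inner f (a n)" for f n
    unfolding S_def inner_transfer_op by (simp add: transfer_op_apply gram)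
  show "bounded_linear S" "norm (S f) \<le> norm f" for f
    unfolding S_def by (rule bounded_linear_transfer_op norm_transfer_op_le)+
  show "S u = v"
    using transfer_op_apply[of a b 0, OF gram] by (simp add: S_def a_def b_def)
  have "adjoint S = transfer_op b a"
    by (rule adjoint_unique) (simp add: S_def inner_transfer_op)
  then show "adjoint S v = u"
    using transfer_op_apply[of b a 0, OF gram[symmetric]] by (simp add: a_def b_def)
  show "B \<circ> S = S \<circ> A"
  proof
    fix f
    \<comment> \<open>The chain is \<open><B S f, b n> = <S f, b (n+1)> = <f, a (n+1)> = <A f, a n>
      = <S A f, b n>\<close>.\<close>
    have perp: "inner (B (S f) - S (A f)) (b n) = 0" for n
      using adj[of f "Suc n"] adj[of "A f" n] by (simp add: inner_diff_left A B a_def b_def)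
    have mem: "S g \<in> closure (span (range b))" for g
      unfolding S_def by (rule transfer_op_in_closure)
    have "B (b n) \<in> span (range b)" for n
    proof -
      have "B (b n) = b (Suc n)"
        by (simp add: b_def)
      then show ?thesis
        by (simp add: span_base)
    qed
    then have "B (S f) \<in> closure (span (range b))"
      using mem by (intro closure_span_invariant[OF B(2)])
    then have "B (S f) - S (A f) = 0"
      using perp mem by (intro orthogonal_closure_span[of _ b] closure_span_diff)
    then show "(B \<circ> S) f = (S \<circ> A) f"
      by simp
  qed
qed

section \<open>Completeness of the space of square-integrable functions\<close>

lemma L2_obtain_rep:
  obtains f where "square_integrable f" "F = abs_L2 f"
proof
  show "square_integrable (rep_L2 F)" "F = abs_L2 (rep_L2 F)"
    using Quotient3_rep_reflp[OF Quotient3_L2, of F] Quotient3_abs_rep[OF Quotient3_L2, of F]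
    by (simp_all add: L2_rel_refl_iff)
qed

lemma abs_L2_eq_iff:
  assumes "square_integrable f" "square_integrable g"
  shows "abs_L2 f = abs_L2 g \<longleftrightarrow> (AE x in unit_leb. f x = g x)"
  using Quotient3_rel[OF Quotient3_L2, of f g] assms by (auto simp: L2_rel_def)

lemma square_integrable_diff:
  assumes "square_integrable f" "square_integrable g"
  shows "square_integrable (\<lambda>x. f x - g x)"
  using square_integrable_add[OF assms(1) square_integrable_cmult[OF assms(2), of "-1"]] by simp

lemma abs_L2_add:
  assumes "square_integrable f" "square_integrable g"
  shows "abs_L2 f + abs_L2 g = abs_L2 (\<lambda>x. f x + g x)"
  using assms by (simp add: plus_L2.abs_eq L2_rel_refl_iff)

lemma abs_L2_scaleR:
  assumes "square_integrable f"
  shows "c *\<^sub>R abs_L2 f = abs_L2 (\<lambda>x. c * f x)"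
  using assms by (simp add: scaleR_L2.abs_eq L2_rel_refl_iff)

lemma abs_L2_diff:
  assumes "square_integrable f" "square_integrable g"
  shows "abs_L2 f - abs_L2 g = abs_L2 (\<lambda>x. f x - g x)"
proof -
  have "abs_L2 f - abs_L2 g = abs_L2 f + (-1) *\<^sub>R abs_L2 g"
    by simp
  then show ?thesis
    unfolding abs_L2_scaleR[OF assms(2)]
    by (simp add: abs_L2_add[OF assms(1) square_integrable_cmult[OF assms(2), of "-1", simplified]])
qed

lemma inner_abs_L2:
  assumes "square_integrable f" "square_integrable g"
  shows "inner (abs_L2 f) (abs_L2 g) = integral\<^sup>L unit_leb (\<lambda>x. f x * g x)"
  using assms by (simp add: inner_L2.abs_eq L2_rel_refl_iff)

lemma norm_abs_L2:
  assumes "square_integrable f"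
  shows "(norm (abs_L2 f))\<^sup>2 = integral\<^sup>L unit_leb (\<lambda>x. (f x)\<^sup>2)"
  using inner_abs_L2[OF assms assms] by (simp add: dot_square_norm power2_eq_square)

lemma one_L2_eq: "one_L2 = abs_L2 (\<lambda>_. 1)"
  by (simp add: one_L2.abs_eq)

lemma norm_one_L2: "norm one_L2 = 1"
proof -
  have "(norm one_L2)\<^sup>2 = 1"
    unfolding one_L2_eq norm_abs_L2[OF square_integrable_const]
    by (simp add: measure_restrict_space)
  then show ?thesis
    by (simp add: power2_eq_1_iff) (use norm_ge_zero[of one_L2] in linarith)
qed

lemma square_integrable_abs:
  assumes "square_integrable f"
  shows "square_integrable (\<lambda>x. \<bar>f x\<bar>)"
  using assms by (auto simp: square_integrable_def)

text \<open>Cauchy-Schwarz against the constant one, which is a unit vector.\<close>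

lemma integral_abs_le_norm_L2:
  assumes "square_integrable f"
  shows "integral\<^sup>L unit_leb (\<lambda>x. \<bar>f x\<bar>) \<le> norm (abs_L2 f)"
proof -
  have "integral\<^sup>L unit_leb (\<lambda>x. \<bar>f x\<bar>) = inner (abs_L2 (\<lambda>x. \<bar>f x\<bar>)) one_L2"
    by (simp add: one_L2_eq inner_abs_L2 square_integrable_abs square_integrable_const assms)
  also have "\<dots> \<le> norm (abs_L2 (\<lambda>x. \<bar>f x\<bar>))"
    using norm_cauchy_schwarz[of "abs_L2 (\<lambda>x. \<bar>f x\<bar>)" one_L2] by (simp add: norm_one_L2)
  also have "\<dots> = norm (abs_L2 f)"
    by (rule power2_eq_imp_eq) (simp_all add: norm_abs_L2 square_integrable_abs assms)
  finally show ?thesis .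
qed

text \<open>Riesz--Fischer: a sequence that is Cauchy in the mean has an almost everywhere convergent
  subsequence, and Fatou's lemma turns the pointwise limit into a limit in norm.\<close>

lemma L2_convergent:
  fixes F :: "nat \<Rightarrow> L2"
  assumes "Cauchy F"
  shows "convergent F"
proof -
  have "\<forall>n. \<exists>f. square_integrable f \<and> F n = abs_L2 f"
    by (metis L2_obtain_rep)
  then obtain f where f: "\<And>n. square_integrable (f n)" and F: "\<And>n. F n = abs_L2 (f n)"
    by metis
  have [measurable]: "f n \<in> borel_measurable unit_leb" for n
    using f[of n] by (simp add: square_integrable_def)
  \<comment> \<open>A Cauchy sequence in norm is Cauchy in the mean, because the L1 norm is at most
    the L2 norm here.\<close>
  have "\<exists>N. \<forall>i\<ge>N. \<forall>j\<ge>N. (LINT x|unit_leb. norm (f i x - f j x)) < e" if "e > 0" for e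
  proof -
    obtain N where "\<And>i j. i \<ge> N \<Longrightarrow> j \<ge> N \<Longrightarrow> norm (F i - F j) < e"
      using assms \<open>e > 0\<close> unfolding Cauchy_def dist_norm by metis
    then have "(LINT x|unit_leb. norm (f i x - f j x)) < e" if "i \<ge> N" "j \<ge> N" for i j
      using integral_abs_le_norm_L2[OF square_integrable_diff[OF f f], of i j] that
      by (force simp: F abs_L2_diff f)
    then show ?thesis by blast
  qed
  then obtain r where r: "strict_mono r" "AE x in unit_leb. Cauchy (\<lambda>i. f (r i) x)"
    by (rule cauchy_L1_AE_cauchy_subseq[OF square_integrable_integrable[OF f]])
  \<comment> \<open>At points where the subsequence diverges the value is arbitrary; these form a
    null set.\<close>
  define g where "g x = lim (\<lambda>i. f (r i) x)" for x
  have lim: "AE x in unit_leb. (\<lambda>i. f (r i) x) \<longlonglongrightarrow> g x"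
    using r(2) by eventually_elim (simp add: g_def Cauchy_convergent_iff convergent_LIMSEQ_iff)
  have [measurable]: "g \<in> borel_measurable unit_leb"
    unfolding g_def by measurable
  have fatou: "(\<integral>\<^sup>+x. ennreal ((g x - f n x)\<^sup>2) \<partial>unit_leb) \<le> ennreal (e\<^sup>2)"
    if N: "\<And>i. i \<ge> N \<Longrightarrow> norm (F i - F n) \<le> e" for n N e
  proof -
    have "AE x in unit_leb. ennreal ((g x - f n x)\<^sup>2) = liminf (\<lambda>i. ennreal ((f (r i) x - f n x)\<^sup>2))"
      using lim
    proof eventually_elim
      case (elim x)
      then have "(\<lambda>i. ennreal ((f (r i) x - f n x)\<^sup>2)) \<longlonglongrightarrow> ennreal ((g x - f n x)\<^sup>2)"
        by (intro tendsto_intros)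
      then show ?case
        by (rule lim_imp_Liminf[OF trivial_limit_sequentially, symmetric])
    qed
    then have "(\<integral>\<^sup>+x. ennreal ((g x - f n x)\<^sup>2) \<partial>unit_leb) =
        (\<integral>\<^sup>+x. liminf (\<lambda>i. ennreal ((f (r i) x - f n x)\<^sup>2)) \<partial>unit_leb)"
      by (rule nn_integral_cong_AE)
    also have "\<dots> \<le> liminf (\<lambda>i. \<integral>\<^sup>+x. ennreal ((f (r i) x - f n x)\<^sup>2) \<partial>unit_leb)"
      by (rule nn_integral_liminf) measurable
    also have "\<dots> \<le> ennreal (e\<^sup>2)"
    proof (rule Liminf_le)
      have "(\<integral>\<^sup>+x. ennreal ((f (r i) x - f n x)\<^sup>2) \<partial>unit_leb) \<le> ennreal (e\<^sup>2)" if "i \<ge> N" for i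
      proof -
        have "(\<integral>\<^sup>+x. ennreal ((f (r i) x - f n x)\<^sup>2) \<partial>unit_leb) =
            ennreal (integral\<^sup>L unit_leb (\<lambda>x. (f (r i) x - f n x)\<^sup>2))"
          using square_integrable_diff[OF f f, of "r i" n]
          by (intro nn_integral_eq_integral) (auto simp: square_integrable_def)
        also have "\<dots> = ennreal ((norm (F (r i) - F n))\<^sup>2)"
          by (simp add: F abs_L2_diff f norm_abs_L2 square_integrable_diff)
        also have "\<dots> \<le> ennreal (e\<^sup>2)"
          \<comment> \<open>The subsequence inherits the bound since
            \<open>r i \<ge> i\<close>.\<close>
          using N[of "r i"] seq_suble[OF r(1), of i] that by (intro ennreal_leI power_mono) auto
        finally show ?thesis .
      qed
      then show "\<forall>\<^sub>F i in sequentially. (\<integral>\<^sup>+x. ennreal ((f (r i) x - f n x)\<^sup>2) \<partial>unit_leb) \<le> ennreal (e\<^sup>2)"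
        by (auto simp: eventually_sequentially)
    qed simp
    finally show ?thesis .
  qed
  have diff: "square_integrable (\<lambda>x. g x - f n x)" and close: "norm (abs_L2 (\<lambda>x. g x - f n x)) \<le> e"
    if N: "\<And>i. i \<ge> N \<Longrightarrow> norm (F i - F n) \<le> e" for n N e
  proof -
    have e: "e \<ge> 0"
      using N[of N] norm_ge_zero order_trans by blast
    have "(\<integral>\<^sup>+x. ennreal ((g x - f n x)\<^sup>2) \<partial>unit_leb) < \<infinity>"
      using fatou[OF N] by (metis ennreal_less_top infinity_ennreal_def le_less_trans)
    then show si: "square_integrable (\<lambda>x. g x - f n x)"
      unfolding square_integrable_def by (simp add: integrable_iff_bounded)
    have "ennreal ((norm (abs_L2 (\<lambda>x. g x - f n x)))\<^sup>2) \<le> ennreal (e\<^sup>2)"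
      using fatou[OF N] si
      by (simp add: norm_abs_L2 square_integrable_def flip: nn_integral_eq_integral)
    then show "norm (abs_L2 (\<lambda>x. g x - f n x)) \<le> e"
      using e by (simp add: power2_le_iff_abs_le)
  qed
  have ex: "\<exists>N. \<forall>n\<ge>N. \<forall>i\<ge>N. norm (F i - F n) \<le> e" if "e > 0" for e
    using assms that unfolding Cauchy_def dist_norm by (meson less_imp_le)
  \<comment> \<open>The bound 1 is only used to see that \<open>g - f N\<close>, and hence
    \<open>g\<close>, is square-integrable.\<close>
  obtain N where "\<And>i. i \<ge> N \<Longrightarrow> norm (F i - F N) \<le> 1"
    using ex[of 1] by auto
  from square_integrable_add[OF diff[OF this] f[of N]] have g: "square_integrable g"
    by simp
  have "F \<longlonglongrightarrow> abs_L2 g"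
  proof (rule metric_LIMSEQ_I)
    fix e :: real assume "e > 0"
    then obtain N where N: "\<And>n i. n \<ge> N \<Longrightarrow> i \<ge> N \<Longrightarrow> norm (F i - F n) \<le> e / 2"
      using ex[of "e / 2"] by auto
    have "dist (F n) (abs_L2 g) < e" if "n \<ge> N" for n
    proof -
      have "norm (abs_L2 (\<lambda>x. g x - f n x)) \<le> e / 2"
        by (rule close[of N]) (rule N[OF that])
      moreover have "dist (F n) (abs_L2 g) = norm (abs_L2 (\<lambda>x. g x - f n x))"
        by (metis F abs_L2_diff dist_commute dist_norm f g)
      ultimately show ?thesis
        using \<open>e > 0\<close> by simp
    qed
    then show "\<exists>N. \<forall>n\<ge>N. dist (F n) (abs_L2 g) < e"
      by blast
  qed
  then show ?thesis
    by (auto simp: convergent_def)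
qed

instance L2 :: banach
  by standard (rule L2_convergent)

section \<open>Borel representatives\<close>

lemma emeasure_completion_Un_subset_null:
  assumes "C \<in> sets M" "N \<subseteq> N'" "N' \<in> null_sets M"
  shows "emeasure (completion M) (C \<union> N) = emeasure M C"
proof -
  have "N \<in> null_sets (completion M)"
    using assms null_sets_completionI null_sets_completion_subset by blast
  then have "emeasure (completion M) (C \<union> N) = emeasure (completion M) C"
    using assms(1) by (intro emeasure_Un_null_set) auto
  then show ?thesis
    using assms(1) by simp
qed

text \<open>Both sigma-algebras consist of sets \<open>C \<union> N\<close> with \<open>C\<close>
  measurable and \<open>N\<close> inside a null set, and intersecting with \<open>S\<close>
  preserves this form. It turns Lebesgue measure on the interval into the completion of Borel
  measure there.\<close>

lemma completion_restrict_space: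
  assumes S: "S \<in> sets M"
  shows "restrict_space (completion M) S = completion (restrict_space M S)"
proof (rule measure_eqI)
  have S': "S \<inter> space M = S" "S \<inter> space (completion M) \<in> sets (completion M)"
    using S sets.sets_into_space by auto
  show sets: "sets (restrict_space (completion M) S) = sets (completion (restrict_space M S))"
  proof (intro subset_antisym subsetI)
    fix A assume "A \<in> sets (restrict_space (completion M) S)"
    then obtain B where "B \<in> sets (completion M)" "A = S \<inter> B"
      by (auto simp: sets_restrict_space)
    then obtain C N N' where "B = C \<union> N" "N \<subseteq> N'" "N' \<in> null_sets M" "C \<in> sets M"
      by (auto elim: sets_completionE)
    then show "A \<in> sets (completion (restrict_space M S))"
      using \<open>A = S \<inter> B\<close> S
      by (intro sets_completionI[of _ "S \<inter> C" "S \<inter> N" "S \<inter> N'"])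
         (auto simp: sets_restrict_space null_sets_restrict_space intro: null_set_Int1)
  next
    fix A assume "A \<in> sets (completion (restrict_space M S))"
    then obtain C N N' where "A = C \<union> N" "N \<subseteq> N'" "N' \<in> null_sets (restrict_space M S)"
        "C \<in> sets (restrict_space M S)"
      by (auto elim: sets_completionE)
    moreover from this have "A \<in> sets (completion M)" "A \<subseteq> S"
      using S by (auto simp: null_sets_restrict_space sets_restrict_space_iff
          intro!: sets_completionI[of _ C N N'])
    ultimately show "A \<in> sets (restrict_space (completion M) S)"
      using S' by (simp add: sets_restrict_space_iff)
  qed
  fix A assume A: "A \<in> sets (restrict_space (completion M) S)"
  then obtain C N N' where C: "A = C \<union> N" "N \<subseteq> N'" "N' \<in> null_sets (restrict_space M S)"
      "C \<in> sets (restrict_space M S)"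
    unfolding sets by (auto elim: sets_completionE)
  have "emeasure (restrict_space (completion M) S) A = emeasure (completion M) A"
    using A S' by (intro emeasure_restrict_space) (auto simp: sets_restrict_space)
  also have "\<dots> = emeasure M C"
    unfolding C(1) using C S
    by (intro emeasure_completion_Un_subset_null[of C M N N'])
       (auto simp: null_sets_restrict_space sets_restrict_space_iff)
  also have "\<dots> = emeasure (restrict_space M S) C"
    using C S by (intro emeasure_restrict_space[symmetric]) (auto simp: sets_restrict_space)
  also have "\<dots> = emeasure (completion (restrict_space M S)) A"
    unfolding C(1) using C(2-4)
    by (intro emeasure_completion_Un_subset_null[of C _ N N', symmetric])
  finally show "emeasure (restrict_space (completion M) S) A = emeasure (completion (restrict_space M S)) A" .
qed

text \<open>Outside a null set the preimages under \<open>f\<close> and \<open>g\<close> coincide,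
  and the remaining piece is a subset of a null set, hence measurable for the completion.\<close>

lemma borel_measurable_completion_AE:
  assumes g: "g \<in> borel_measurable M" and ae: "AE x in M. f x = g x"
  shows "f \<in> borel_measurable (completion M)"
proof (rule measurableI)
  obtain N where N: "N \<in> null_sets M" "{x \<in> space M. f x \<noteq> g x} \<subseteq> N"
    using ae unfolding eventually_ae_filter by blast
  fix A :: "'b set" assume A: "A \<in> sets borel"
  show "f -` A \<inter> space (completion M) \<in> sets (completion M)"
  proof (rule sets_completionI)
    show "f -` A \<inter> space (completion M) = (g -` A \<inter> space M - N) \<union> (f -` A \<inter> space M \<inter> N)"
      using N(2) by auto
    show "g -` A \<inter> space M - N \<in> sets M"
      using measurable_sets[OF g A] N(1) by auto
  qed (use N in auto)
qed simp

text \<open>This allows integrands built from a merely Lebesgue measurable graphon to be replaced by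
  Borel ones.\<close>

lemma integral_completion_AE:
  fixes g :: "'a \<Rightarrow> real"
  assumes g: "g \<in> borel_measurable M" and ae: "AE x in M. f x = g x"
  shows "integral\<^sup>L (completion M) f = integral\<^sup>L M g"
proof -
  have "integral\<^sup>L (completion M) f = integral\<^sup>L (completion M) g"
    using assms by (intro integral_cong_AE borel_measurable_completion_AE measurable_completion AE_completion)
  then show ?thesis
    using g by (simp add: integral_completion)
qed

section \<open>Borel measure on the unit interval and Borel versions of graphons\<close>

abbreviation unit_borel :: "real measure" where
  "unit_borel \<equiv> restrict_space lborel {0..1}"

lemma unit_leb_eq_completion: "unit_leb = completion unit_borel"
  by (rule completion_restrict_space) simp

interpretation unit_borel: prob_space unit_borel
  by standard (simp add: emeasure_restrict_space)

interpretation unit_borel_pair: pair_prob_space unit_borel unit_borel ..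

lemma AE_unit_leb_I: "(AE x in unit_borel. P x) \<Longrightarrow> AE x in unit_leb. P x"
  unfolding unit_leb_eq_completion by (rule AE_completion)

lemma borel_measurable_unit_leb: "f \<in> borel_measurable unit_borel \<Longrightarrow> f \<in> borel_measurable unit_leb"
  unfolding unit_leb_eq_completion by (rule measurable_completion)

lemma square_integrable_cong_AE:
  assumes "square_integrable g" "f \<in> borel_measurable unit_leb" "AE x in unit_leb. g x = f x"
  shows "square_integrable f"
  using assms unfolding square_integrable_def
  by (auto intro!: integrable_cong_AE_imp[of _ "\<lambda>x. (g x)\<^sup>2"] elim: eventually_mono)

lemma integrable_unit_borel:
  assumes "square_integrable f" "f \<in> borel_measurable unit_borel"
  shows "integrable unit_borel f"
  using square_integrable_integrable[OF assms(1)] assms(2)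
  unfolding unit_leb_eq_completion by (simp add: integrable_completion)

lemma inner_abs_L2_borel:
  assumes f: "square_integrable f" "f \<in> borel_measurable unit_borel"
    and g: "square_integrable g" "g \<in> borel_measurable unit_borel"
  shows "inner (abs_L2 f) (abs_L2 g) = integral\<^sup>L unit_borel (\<lambda>x. f x * g x)"
  unfolding inner_abs_L2[OF f(1) g(1)] unit_leb_eq_completion
  using f(2) g(2) by (intro integral_completion borel_measurable_times)

lemma L2_obtain_borel_rep:
  obtains f where "square_integrable f" "f \<in> borel_measurable unit_borel" "F = abs_L2 f"
proof -
  obtain g where g: "square_integrable g" "F = abs_L2 g"
    by (rule L2_obtain_rep)
  then obtain f where f: "f \<in> borel_measurable unit_borel" "AE x in unit_borel. g x = f x"
    unfolding square_integrable_def unit_leb_eq_completion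
    using completion_ex_borel_measurable_real by blast
  have ae: "AE x in unit_leb. g x = f x"
    by (rule AE_unit_leb_I) (rule f(2))
  have "square_integrable f"
    using square_integrable_cong_AE[OF g(1) borel_measurable_unit_leb[OF f(1)] ae] .
  then show thesis
    using that f(1) ae g abs_L2_eq_iff by blast
qed

text \<open>A Borel kernel that agrees with a Lebesgue measurable graphon outside a null set; it makes
  Fubini's theorem for the product sigma-algebra applicable.\<close>
definition borel_version :: "(real \<Rightarrow> real \<Rightarrow> real) \<Rightarrow> (real \<times> real \<Rightarrow> real) \<Rightarrow> bool" where
  "borel_version W V \<longleftrightarrow>
     V \<in> borel_measurable (unit_borel \<Otimes>\<^sub>M unit_borel) \<and>
     (\<forall>x y. V (x, y) = V (y, x)) \<and> (\<forall>z. 0 \<le> V z \<and> V z \<le> 1) \<and>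
     (\<exists>N\<in>sets (unit_borel \<Otimes>\<^sub>M unit_borel). (AE x in unit_borel. AE y in unit_borel. (x, y) \<notin> N) \<and>
       (\<forall>x\<in>{0..1}. \<forall>y\<in>{0..1}. (x, y) \<notin> N \<longrightarrow> W x y = V (x, y)))"

lemma ex_borel_version:
  assumes W: "graphon W"
  obtains V where "borel_version W V"
proof -
  let ?S = "{0..1::real} \<times> {0..1::real}"
  let ?W0 = "\<lambda>z. if z \<in> ?S then (\<lambda>(x, y). W x y) z else 0"
  have "?S \<in> sets lebesgue"
    by (intro lmeasurable_compact fmeasurableD compact_Times) auto
  then have "?W0 \<in> borel_measurable lebesgue"
    using W by (intro borel_measurable_if_I) (auto simp: graphon_def)
  then obtain W' where W': "W' \<in> borel_measurable lborel" "AE z in lborel. ?W0 z = W' z"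
    by (auto dest: completion_ex_borel_measurable_real)
  then obtain N where N: "{z. ?W0 z \<noteq> W' z} \<subseteq> N" "N \<in> null_sets (lborel :: (real \<times> real) measure)"
    unfolding eventually_ae_filter by auto
  have [measurable]: "W' \<in> borel_measurable (borel \<Otimes>\<^sub>M borel)" "N \<in> sets (borel \<Otimes>\<^sub>M borel)"
    using W'(1) null_setsD2[OF N(2)] unfolding borel_prod by simp_all
  have [measurable]: "(\<lambda>x. x) \<in> unit_borel \<rightarrow>\<^sub>M borel"
    by (simp add: measurable_restrict_space1)
  \<comment> \<open>Clamping to the unit interval and averaging over the swap of arguments make the
    bounds and the symmetry hold at every point, not only almost everywhere.\<close>
  define V where "V = (\<lambda>(x, y). (max 0 (min 1 (W' (x, y))) + max 0 (min 1 (W' (y, x)))) / 2)"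
  \<comment> \<open>Since \<open>V\<close> reads \<open>W'\<close> at both \<open>(x, y)\<close> and
    \<open>(y, x)\<close>, the exceptional set must contain the mirror image of \<open>N\<close> as
    well.\<close>
  define N' where "N' = {z \<in> space (unit_borel \<Otimes>\<^sub>M unit_borel). (fst z, snd z) \<in> N \<or> (snd z, fst z) \<in> N}"
  have "AE z in lborel \<Otimes>\<^sub>M lborel. z \<notin> N"
    unfolding lborel_prod by (rule AE_not_in[OF N(2)])
  then have 1: "AE x in lborel. AE y in lborel. (x, y) \<notin> N"
    by (rule lborel_pair.AE_pair)
  then have 2: "AE x in lborel. AE y in lborel. (y, x) \<notin> N"
    by (subst lborel_pair.AE_commute) measurable
  have "AE x in lborel. AE y in lborel. (x, y) \<notin> N \<and> (y, x) \<notin> N"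
    using 1 2 by eventually_elim (rule eventually_conj)
  moreover have restrict: "(AE x in lborel. P x) \<Longrightarrow> AE x in unit_borel. P x" for P
    by (simp add: AE_restrict_space_iff) (auto elim: eventually_mono)
  ultimately have "AE x in unit_borel. AE y in lborel. (x, y) \<notin> N \<and> (y, x) \<notin> N"
    by blast
  then have "AE x in unit_borel. AE y in unit_borel. (x, y) \<notin> N'"
  proof eventually_elim
    case (elim x)
    from restrict[OF elim] show ?case
      by eventually_elim (simp add: N'_def)
  qed
  moreover have "N' \<in> sets (unit_borel \<Otimes>\<^sub>M unit_borel)"
    unfolding N'_def by measurable
  moreover have "W x y = V (x, y)" if "x \<in> {0..1}" "y \<in> {0..1}" "(x, y) \<notin> N'" for x y
  proof -
    have "(x, y) \<notin> N" "(y, x) \<notin> N"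
      using that by (auto simp: N'_def space_pair_measure space_restrict_space)
    then have "W' (x, y) = W x y" "W' (y, x) = W y x"
      using N(1) that by force+
    then show ?thesis
      using W that by (auto simp: V_def graphon_def)
  qed
  moreover have "V \<in> borel_measurable (unit_borel \<Otimes>\<^sub>M unit_borel)"
    unfolding V_def by measurable
  ultimately show thesis
    by (intro that[of V])
       (auto simp: borel_version_def V_def add.commute intro!: bexI[of _ N'])
qed

section \<open>The integral operator of a Borel version: boundedness, self-adjointness and
  moments\<close>

definition kernel_int :: "(real \<times> real \<Rightarrow> real) \<Rightarrow> (real \<Rightarrow> real) \<Rightarrow> real \<Rightarrow> real" where
  "kernel_int V f x = integral\<^sup>L unit_borel (\<lambda>y. V (x, y) * f y)"

context
  fixes W :: "real \<Rightarrow> real \<Rightarrow> real" and V :: "real \<times> real \<Rightarrow> real"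
  assumes WV: "borel_version W V"
begin

lemma borel_version_measurable [measurable]: "V \<in> borel_measurable (unit_borel \<Otimes>\<^sub>M unit_borel)"
  using WV by (simp add: borel_version_def)

lemma borel_version_sym: "V (x, y) = V (y, x)"
  using WV by (simp add: borel_version_def)

lemma borel_version_nonneg: "0 \<le> V z" and borel_version_le_1: "V z \<le> 1"
  using WV unfolding borel_version_def by blast+

lemma borel_version_mult_le: "\<bar>V z * c\<bar> \<le> \<bar>c\<bar>"
  using borel_version_nonneg[of z] borel_version_le_1[of z]
  by (simp add: abs_mult mult_left_le_one_le)

lemma kernel_int_measurable [measurable]:
  assumes [measurable]: "f \<in> borel_measurable unit_borel"
  shows "kernel_int V f \<in> borel_measurable unit_borel"
  unfolding kernel_int_def by measurable

lemma integrable_borel_version_mult: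
  assumes f: "integrable unit_borel f" and x: "x \<in> space unit_borel"
  shows "integrable unit_borel (\<lambda>y. V (x, y) * f y)"
proof (rule Bochner_Integration.integrable_bound[OF f])
  have [measurable]: "f \<in> borel_measurable unit_borel"
    using f by auto
  show "(\<lambda>y. V (x, y) * f y) \<in> borel_measurable unit_borel"
    using x by measurable
qed (simp add: borel_version_mult_le)

lemma abs_kernel_int_le:
  assumes f: "integrable unit_borel f" and x: "x \<in> space unit_borel"
  shows "\<bar>kernel_int V f x\<bar> \<le> integral\<^sup>L unit_borel (\<lambda>y. \<bar>f y\<bar>)"
proof -
  have "\<bar>kernel_int V f x\<bar> \<le> integral\<^sup>L unit_borel (\<lambda>y. \<bar>V (x, y) * f y\<bar>)"
    unfolding kernel_int_def by (rule integral_abs_bound)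
  also have "\<dots> \<le> integral\<^sup>L unit_borel (\<lambda>y. \<bar>f y\<bar>)"
    using f integrable_borel_version_mult[OF f x] by (intro integral_mono) (auto simp: borel_version_mult_le)
  finally show ?thesis .
qed

text \<open>For almost every \<open>x\<close> the section of \<open>W\<close> at \<open>x\<close>
  equals that of \<open>V\<close> almost everywhere. The section of \<open>W\<close> need not be
  Borel, so its integral is taken over the completion.\<close>

lemma kernel_fun_AE:
  assumes f[measurable]: "f \<in> borel_measurable unit_borel"
  shows "AE x in unit_leb. kernel_fun W f x = kernel_int V f x"
proof -
  obtain N where N: "AE x in unit_borel. AE y in unit_borel. (x, y) \<notin> N"
      "\<And>x y. x \<in> {0..1} \<Longrightarrow> y \<in> {0..1} \<Longrightarrow> (x, y) \<notin> N \<Longrightarrow> W x y = V (x, y)"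
    using WV by (auto simp: borel_version_def)
  have "AE x in unit_borel. kernel_fun W f x = kernel_int V f x"
    using N(1) AE_space
  proof eventually_elim
    case (elim x)
    have "AE y in unit_borel. W x y * f y = V (x, y) * f y"
      using elim(1) AE_space
      by eventually_elim (use elim(2) N(2) in \<open>auto simp: space_restrict_space\<close>)
    then show ?case
      unfolding kernel_fun_def kernel_int_def unit_leb_eq_completion
      using elim(2) by (intro integral_completion_AE) measurable
  qed
  then show ?thesis
    by (rule AE_unit_leb_I)
qed

context
  assumes W: "graphon W"
begin

lemma square_integrable_kernel_int:
  assumes "square_integrable f" "f \<in> borel_measurable unit_borel"
  shows "square_integrable (kernel_int V f)"
proof (rule square_integrable_cong_AE)
  show "square_integrable (kernel_fun W f)"
    by (rule square_integrable_kernel_fun[OF W assms(1)])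
  show "kernel_int V f \<in> borel_measurable unit_leb"
    by (intro borel_measurable_unit_leb kernel_int_measurable assms)
  show "AE x in unit_leb. kernel_fun W f x = kernel_int V f x"
    by (rule kernel_fun_AE[OF assms(2)])
qed

lemma graphon_op_abs_borel:
  assumes f: "square_integrable f" "f \<in> borel_measurable unit_borel"
  shows "graphon_op W (abs_L2 f) = abs_L2 (kernel_int V f)"
  using f W by (simp add: graphon_op_abs abs_L2_eq_iff square_integrable_kernel_fun
      square_integrable_kernel_int kernel_fun_AE)

text \<open>As \<open>0 \<le> V \<le> 1\<close>, the image function is bounded pointwise by the L1
  norm of \<open>f\<close>, which is at most its L2 norm; squaring and integrating over an interval
  of length 1 keeps this bound.\<close>

lemma norm_graphon_op_le: "norm (graphon_op W F) \<le> norm F"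
proof -
  obtain f where f: "square_integrable f" and [measurable]: "f \<in> borel_measurable unit_borel"
      and F: "F = abs_L2 f"
    by (rule L2_obtain_borel_rep)
  note int = integrable_unit_borel[OF f \<open>f \<in> borel_measurable unit_borel\<close>]
  let ?k = "kernel_int V f"
  have k: "square_integrable ?k"
    by (rule square_integrable_kernel_int[OF f]) measurable
  have "integral\<^sup>L unit_borel (\<lambda>y. \<bar>f y\<bar>) = integral\<^sup>L unit_leb (\<lambda>y. \<bar>f y\<bar>)"
    unfolding unit_leb_eq_completion by (rule integral_completion[symmetric]) measurable
  then have le: "\<bar>?k x\<bar> \<le> norm F" if "x \<in> space unit_borel" for x
    using abs_kernel_int_le[OF int that] integral_abs_le_norm_L2[OF f] by (simp add: F)
  have "(norm (abs_L2 ?k))\<^sup>2 = integral\<^sup>L unit_leb (\<lambda>x. (?k x)\<^sup>2)"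
    by (rule norm_abs_L2[OF k])
  also have "\<dots> \<le> integral\<^sup>L unit_leb (\<lambda>x. (norm F)\<^sup>2)"
    using k le by (intro integral_mono)
      (auto simp: square_integrable_def space_restrict_space abs_le_square_iff[symmetric])
  also have "\<dots> = (norm F)\<^sup>2"
    by (simp add: measure_restrict_space)
  finally have "norm (abs_L2 ?k) \<le> norm F"
    by (rule power2_le_imp_le) simp
  then show ?thesis
    by (simp add: F graphon_op_abs_borel f)
qed

lemma bounded_linear_graphon_op: "bounded_linear (graphon_op W)"
proof (rule bounded_linear_intro[where K = 1])
  fix F G :: L2 and r :: real
  obtain f where f: "square_integrable f" "f \<in> borel_measurable unit_borel" and F: "F = abs_L2 f"
    by (rule L2_obtain_borel_rep)
  obtain g where g: "square_integrable g" "g \<in> borel_measurable unit_borel" and G: "G = abs_L2 g"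
    by (rule L2_obtain_borel_rep)
  \<comment> \<open>Additivity needs integrable sections, which are available for points of the
    interval only; this is enough for equality of classes. The scalar law below holds at every
    point, since scalars leave the integral in any case.\<close>
  have "kernel_int V (\<lambda>x. f x + g x) x = kernel_int V f x + kernel_int V g x"
    if "x \<in> space unit_borel" for x
    using integrable_borel_version_mult[OF integrable_unit_borel[OF f] that]
      integrable_borel_version_mult[OF integrable_unit_borel[OF g] that]
    by (simp add: kernel_int_def distrib_left)
  then have "abs_L2 (kernel_int V (\<lambda>x. f x + g x)) = abs_L2 (\<lambda>x. kernel_int V f x + kernel_int V g x)"
    using f g by (subst abs_L2_eq_iff)
      (auto intro!: square_integrable_add square_integrable_kernel_int AE_unit_leb_I)
  then show "graphon_op W (F + G) = graphon_op W F + graphon_op W G"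
    using f g by (simp add: F G abs_L2_add graphon_op_abs_borel square_integrable_add
        square_integrable_kernel_int)
  have "kernel_int V (\<lambda>x. r * f x) = (\<lambda>x. r * kernel_int V f x)"
    by (simp add: kernel_int_def fun_eq_iff mult.left_commute)
  then show "graphon_op W (r *\<^sub>R F) = r *\<^sub>R graphon_op W F"
    using f by (simp add: F abs_L2_scaleR graphon_op_abs_borel square_integrable_cmult
        square_integrable_kernel_int)
  show "norm (graphon_op W F) \<le> norm F * 1"
    by (simp add: norm_graphon_op_le)
qed

text \<open>Fubini's theorem together with the symmetry of \<open>V\<close>. Integrability of the
  double integrand \<open>h\<close> follows from the bound \<open>|f y| |g x|\<close>.\<close>

lemma graphon_op_self_adjoint: "inner (graphon_op W F) G = inner F (graphon_op W G)"
proof -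
  obtain f where f: "square_integrable f" and [measurable]: "f \<in> borel_measurable unit_borel"
      and F: "F = abs_L2 f"
    by (rule L2_obtain_borel_rep)
  obtain g where g: "square_integrable g" and [measurable]: "g \<in> borel_measurable unit_borel"
      and G: "G = abs_L2 g"
    by (rule L2_obtain_borel_rep)
  have fi: "integrable unit_borel f" and gi: "integrable unit_borel g"
    using f g by (auto intro: integrable_unit_borel)
  define h where "h x y = V (x, y) * f y * g x" for x y
  have [measurable]: "case_prod h \<in> borel_measurable (unit_borel \<Otimes>\<^sub>M unit_borel)"
    unfolding h_def by measurable
  have hi: "integrable unit_borel (h x)" if "x \<in> space unit_borel" for x
    unfolding h_def using integrable_borel_version_mult[OF fi that] by simp
  have "integrable (unit_borel \<Otimes>\<^sub>M unit_borel) (case_prod h)"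
  proof (rule unit_borel_pair.Fubini_integrable)
    show "integrable unit_borel (\<lambda>x. \<integral>y. norm (case_prod h (x, y)) \<partial>unit_borel)"
    proof (rule Bochner_Integration.integrable_bound)
      show "integrable unit_borel (\<lambda>x. integral\<^sup>L unit_borel (\<lambda>y. \<bar>f y\<bar>) * g x)"
        using gi by simp
      have "(\<integral>y. \<bar>h x y\<bar> \<partial>unit_borel) \<le> integral\<^sup>L unit_borel (\<lambda>y. \<bar>f y\<bar>) * \<bar>g x\<bar>"
        if "x \<in> space unit_borel" for x
      proof -
        have "(\<integral>y. \<bar>h x y\<bar> \<partial>unit_borel) \<le> (\<integral>y. \<bar>f y\<bar> * \<bar>g x\<bar> \<partial>unit_borel)"
        proof (rule integral_mono)
          show "\<bar>h x y\<bar> \<le> \<bar>f y\<bar> * \<bar>g x\<bar>" for y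
            unfolding h_def abs_mult[of _ "g x"] by (intro mult_right_mono borel_version_mult_le) simp
        qed (use hi[OF that] fi in auto)
        then show ?thesis by simp
      qed
      then show "AE x in unit_borel. norm (\<integral>y. norm (case_prod h (x, y)) \<partial>unit_borel) \<le>
          norm (integral\<^sup>L unit_borel (\<lambda>y. \<bar>f y\<bar>) * g x)"
        by (intro AE_I2) (simp add: abs_mult)
    qed measurable
  qed (use hi in auto)
  then have fubini: "(\<integral>y. (\<integral>x. h x y \<partial>unit_borel) \<partial>unit_borel) = (\<integral>x. (\<integral>y. h x y \<partial>unit_borel) \<partial>unit_borel)"
    by (rule unit_borel_pair.Fubini_integral)
  have "inner (graphon_op W F) G = (\<integral>x. kernel_int V f x * g x \<partial>unit_borel)"
    by (simp add: F G graphon_op_abs_borel f g inner_abs_L2_borel square_integrable_kernel_int)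
  also have "\<dots> = (\<integral>x. (\<integral>y. h x y \<partial>unit_borel) \<partial>unit_borel)"
    by (simp add: kernel_int_def h_def)
  also have "\<dots> = (\<integral>y. (\<integral>x. h x y \<partial>unit_borel) \<partial>unit_borel)"
    by (rule fubini[symmetric])
  also have "\<dots> = (\<integral>y. f y * kernel_int V g y \<partial>unit_borel)"
    unfolding h_def kernel_int_def integral_mult_right_zero[symmetric]
    by (simp add: borel_version_sym[of _ "_"] ac_simps)
  also have "\<dots> = inner F (graphon_op W G)"
    by (simp add: F G graphon_op_abs_borel f g inner_abs_L2_borel square_integrable_kernel_int)
  finally show ?thesis .
qed

text \<open>The three claims are proved together because the operator can be computed on a class
  only from a square-integrable Borel representative, which each step must supply again.\<close>

lemma funpow_kernel_int_one:
  "(kernel_int V ^^ n) (\<lambda>_. 1) \<in> borel_measurable unit_borel"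
  "square_integrable ((kernel_int V ^^ n) (\<lambda>_. 1))"
  "(graphon_op W ^^ n) one_L2 = abs_L2 ((kernel_int V ^^ n) (\<lambda>_. 1))"
proof (induction n)
  case (Suc n)
  { case 1 show ?case using Suc by simp }
  { case 2 show ?case using Suc by (simp add: square_integrable_kernel_int) }
  { case 3 show ?case using Suc by (simp add: graphon_op_abs_borel) }
qed (auto simp: square_integrable_const one_L2_eq)

lemma graphon_op_moment:
  "inner ((graphon_op W ^^ n) one_L2) one_L2 = integral\<^sup>L unit_borel ((kernel_int V ^^ n) (\<lambda>_. 1))"
  unfolding funpow_kernel_int_one(3)
  by (simp add: funpow_kernel_int_one(1,2) one_L2_eq inner_abs_L2_borel square_integrable_const)

end

end

section \<open>Path densities as moments\<close>

text \<open>Recursion along the list, in place of a product over the edge set, lets Fubini's theorem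
  remove one end vertex at a time.\<close>

fun path_weight :: "(real \<times> real \<Rightarrow> real) \<Rightarrow> 'a list \<Rightarrow> ('a \<Rightarrow> real) \<Rightarrow> real" where
  "path_weight V (u # v # vs) x = V (x u, x v) * path_weight V (v # vs) x"
| "path_weight V vs x = 1"

lemma path_weight_cong: "(\<And>v. v \<in> set vs \<Longrightarrow> x v = y v) \<Longrightarrow> path_weight V vs x = path_weight V vs y"
  by (induction V vs x rule: path_weight.induct) auto

lemma path_graph_Cons_Cons:
  "snd (path_graph (u # v # vs)) = insert {u, v} (snd (path_graph (v # vs)))"
proof -
  have "{{(u # v # vs) ! i, (u # v # vs) ! Suc i} |i. Suc i < length (u # v # vs)} =
      (\<lambda>i. {(u # v # vs) ! i, (v # vs) ! i}) ` {..<Suc (length vs)}"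
    by auto
  also have "\<dots> = insert {u, v} ((\<lambda>i. {(v # vs) ! i, vs ! i}) ` {..<length vs})"
    by (simp add: lessThan_Suc_eq_insert_0 image_image)
  also have "(\<lambda>i. {(v # vs) ! i, vs ! i}) ` {..<length vs} =
      {{(v # vs) ! i, (v # vs) ! Suc i} |i. Suc i < length (v # vs)}"
    by auto
  finally show ?thesis
    by (simp add: path_graph_def)
qed

text \<open>The first vertex does not occur in the rest of the path, so its edge is new and
  contributes exactly one factor to the product over the edge set.\<close>

lemma prod_edge_value_path:
  assumes W: "graphon W" and "distinct vs" and "\<And>v. v \<in> set vs \<Longrightarrow> x v \<in> {0..1}"
  shows "(\<Prod>e\<in>snd (path_graph vs). edge_value W x e) = path_weight (case_prod W) vs x"
  using assms(2,3)
proof (induction "case_prod W" vs x rule: path_weight.induct)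
  case (1 u v vs x)
  have "finite (snd (path_graph (v # vs)))"
    by (simp add: path_graph_def)
  moreover have "{u, v} \<notin> snd (path_graph (v # vs))"
  proof
    assume e: "{u, v} \<in> snd (path_graph (v # vs))"
    have "is_path (path_graph (v # vs))"
      unfolding is_path_def using "1.prems"(1) by (intro exI[of _ "v # vs"]) simp
    then have "{u, v} \<subseteq> fst (path_graph (v # vs))"
      using e is_path_simple unfolding finite_simple_graph_def by blast
    then have "u \<in> set (v # vs)"
      by (simp add: path_graph_def)
    then show False
      using "1.prems"(1) by auto
  qed
  ultimately show ?case
    using 1 by (simp add: path_graph_Cons_Cons edge_value_eq[OF W])
qed (simp_all add: path_graph_def)

text \<open>Integrate the indicator of \<open>N\<close> over the coordinate \<open>v\<close> first:
  for almost every value of the coordinate \<open>u\<close> the inner integral is zero.\<close>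

lemma AE_PiM_pair:
  assumes N: "N \<in> sets (unit_borel \<Otimes>\<^sub>M unit_borel)"
    and ae: "AE x in unit_borel. AE y in unit_borel. (x, y) \<notin> N"
    and I: "finite I" "u \<in> I" "v \<in> I" "u \<noteq> v"
  shows "AE x in Pi\<^sub>M I (\<lambda>_. unit_borel). (x u, x v) \<notin> N"
proof -
  interpret product_prob_space "\<lambda>_. unit_borel" I
    by unfold_locales
  define J where "J = I - {v}"
  have J: "I = insert v J" "finite J" "v \<notin> J" "u \<in> J"
    using I by (auto simp: J_def)
  note [measurable] = N
  have [measurable]: "(\<lambda>x. x u) \<in> Pi\<^sub>M I (\<lambda>_. unit_borel) \<rightarrow>\<^sub>M unit_borel"
      "(\<lambda>x. x v) \<in> Pi\<^sub>M I (\<lambda>_. unit_borel) \<rightarrow>\<^sub>M unit_borel"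
    using I by (auto intro!: measurable_component_singleton)
  have ind[measurable]: "(\<lambda>x. indicator N (x u, x v) :: ennreal) \<in> borel_measurable (Pi\<^sub>M I (\<lambda>_. unit_borel))"
    by measurable
  have "AE x in Pi\<^sub>M J (\<lambda>_. unit_borel). AE y in unit_borel. (x u, y) \<notin> N"
    by (rule AE_PiM_component[OF _ J(4) ae]) unfold_locales
  then have "AE x in Pi\<^sub>M J (\<lambda>_. unit_borel). (\<integral>\<^sup>+y. indicator N (x u, y) \<partial>unit_borel) = 0"
  proof eventually_elim
    case (elim x)
    then have "AE y in unit_borel. indicator N (x u, y) = (0 :: ennreal)"
      by eventually_elim simp
    then have "(\<integral>\<^sup>+y. indicator N (x u, y) \<partial>unit_borel) = (\<integral>\<^sup>+y. 0 \<partial>unit_borel)"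
      by (rule nn_integral_cong_AE)
    then show ?case by simp
  qed
  then have "(\<integral>\<^sup>+x. (\<integral>\<^sup>+y. indicator N (x u, y) \<partial>unit_borel) \<partial>Pi\<^sub>M J (\<lambda>_. unit_borel)) =
      (\<integral>\<^sup>+x. 0 \<partial>Pi\<^sub>M J (\<lambda>_. unit_borel))"
    by (rule nn_integral_cong_AE)
  moreover have "(\<integral>\<^sup>+x. indicator N (x u, x v) \<partial>Pi\<^sub>M I (\<lambda>_. unit_borel)) =
      (\<integral>\<^sup>+x. (\<integral>\<^sup>+y. indicator N (x u, y) \<partial>unit_borel) \<partial>Pi\<^sub>M J (\<lambda>_. unit_borel))"
    using product_nn_integral_insert[OF J(2,3) ind[unfolded J(1)]] I(4) unfolding J(1) by simp
  ultimately have "(\<integral>\<^sup>+x. indicator N (x u, x v) \<partial>Pi\<^sub>M I (\<lambda>_. unit_borel)) = 0"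
    by simp
  then have "AE x in Pi\<^sub>M I (\<lambda>_. unit_borel). indicator N (x u, x v) = (0 :: ennreal)"
    by (subst (asm) nn_integral_0_iff_AE) simp_all
  then show ?thesis
    by eventually_elim (simp add: indicator_eq_0_iff)
qed

text \<open>The index set \<open>I\<close> is kept apart from the list so that the induction can
  shorten the path while the product space stays fixed.\<close>

lemma AE_path_weight:
  assumes eq: "\<And>x y. x \<in> {0..1} \<Longrightarrow> y \<in> {0..1} \<Longrightarrow> (x, y) \<notin> N \<Longrightarrow> W (x, y) = V (x, y)"
    and N: "N \<in> sets (unit_borel \<Otimes>\<^sub>M unit_borel)"
      "AE x in unit_borel. AE y in unit_borel. (x, y) \<notin> N"
    and I: "finite I" "set vs \<subseteq> I" "distinct vs"
  shows "AE x in Pi\<^sub>M I (\<lambda>_. unit_borel). path_weight W vs x = path_weight V vs x"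
  using I(2,3)
proof (induction vs rule: induct_list012)
  case (3 u v vs)
  have "AE x in Pi\<^sub>M I (\<lambda>_. unit_borel). (x u, x v) \<notin> N"
    using 3 by (intro AE_PiM_pair[OF N I(1)]) auto
  moreover have "AE x in Pi\<^sub>M I (\<lambda>_. unit_borel). path_weight W (v # vs) x = path_weight V (v # vs) x"
    using 3 by simp
  ultimately show ?case
    using AE_space
  proof eventually_elim
    case (elim x)
    have "x u \<in> {0..1}" "x v \<in> {0..1}"
      using elim(3) "3.prems" by (auto simp: space_PiM space_restrict_space dest: PiE_mem)
    then show ?case
      using eq elim by simp
  qed
qed simp_all

context
  fixes W :: "real \<Rightarrow> real \<Rightarrow> real" and V :: "real \<times> real \<Rightarrow> real"
  assumes WV: "borel_version W V"
begin

lemma path_weight_measurable: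
  assumes "set vs \<subseteq> I"
  shows "path_weight V vs \<in> borel_measurable (Pi\<^sub>M I (\<lambda>_. unit_borel))"
  using assms
proof (induction vs rule: induct_list012)
  case (3 u v vs)
  note [measurable] = borel_version_measurable[OF WV]
  have [measurable]: "path_weight V (v # vs) \<in> borel_measurable (Pi\<^sub>M I (\<lambda>_. unit_borel))"
    using 3 by simp
  have [measurable]: "(\<lambda>x. x u) \<in> Pi\<^sub>M I (\<lambda>_. unit_borel) \<rightarrow>\<^sub>M unit_borel"
      "(\<lambda>x. x v) \<in> Pi\<^sub>M I (\<lambda>_. unit_borel) \<rightarrow>\<^sub>M unit_borel"
    using 3 by (auto intro!: measurable_component_singleton)
  show ?case
    by (subst path_weight.simps(1)[abs_def]) measurable
next
  case 1
  have "path_weight V [] = (\<lambda>_. 1)"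
    by (simp add: fun_eq_iff)
  then show ?case by simp
next
  case (2 u)
  have "path_weight V [u] = (\<lambda>_. 1)"
    by (simp add: fun_eq_iff)
  then show ?case by simp
qed

lemma path_weight_bounds: "0 \<le> path_weight V vs x \<and> path_weight V vs x \<le> 1"
  using borel_version_nonneg[OF WV] borel_version_le_1[OF WV]
  by (induction V vs x rule: path_weight.induct) (auto intro: mult_le_one)

text \<open>The factor \<open>h\<close> at the first vertex makes the induction work: integrating
  out \<open>u\<close> replaces \<open>h\<close> at \<open>u\<close> by
  \<open>kernel_int V h\<close> at the next vertex. The bound \<open>c\<close> provides the
  integrability needed for Fubini's theorem.\<close>

lemma integral_path_weight:
  assumes "distinct (u # vs)" and "h \<in> borel_measurable unit_borel"
    and "\<And>y. y \<in> space unit_borel \<Longrightarrow> \<bar>h y\<bar> \<le> c"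
  shows "(\<integral>x. h (x u) * path_weight V (u # vs) x \<partial>Pi\<^sub>M (set (u # vs)) (\<lambda>_. unit_borel)) =
    integral\<^sup>L unit_borel ((kernel_int V ^^ length vs) h)"
  using assms
proof (induction vs arbitrary: u h)
  case Nil
  interpret product_prob_space "\<lambda>_. unit_borel" "{u}"
    by unfold_locales
  show ?case
    using product_integral_singleton[of h u] Nil by simp
next
  case (Cons w ws)
  let ?J = "set (w # ws)"
  interpret product_prob_space "\<lambda>_. unit_borel" "insert u ?J"
    by unfold_locales
  note [measurable] = Cons.prems(2) borel_version_measurable[OF WV]
  have [measurable]: "path_weight V (u # w # ws) \<in> borel_measurable (Pi\<^sub>M (insert u ?J) (\<lambda>_. unit_borel))"
    by (rule path_weight_measurable) simp
  have [measurable]: "(\<lambda>x. x u) \<in> Pi\<^sub>M (insert u ?J) (\<lambda>_. unit_borel) \<rightarrow>\<^sub>M unit_borel"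
    by (rule measurable_component_singleton) simp
  have u: "u \<notin> ?J" "u \<noteq> w"
    using Cons.prems(1) by auto
  have hi: "integrable unit_borel h"
  proof (rule unit_borel.integrable_const_bound)
    show "AE y in unit_borel. norm (h y) \<le> c"
      using Cons.prems(3) by (intro AE_I2) (simp only: real_norm_def)
  qed (rule Cons.prems(2))
  have "integrable (Pi\<^sub>M (insert u ?J) (\<lambda>_. unit_borel)) (\<lambda>x. h (x u) * path_weight V (u # w # ws) x)"
  proof (rule finite_measure.integrable_const_bound)
    show "finite_measure (Pi\<^sub>M (insert u ?J) (\<lambda>_. unit_borel))"
      by (intro prob_space.finite_measure prob_space_PiM) unfold_locales
    have "\<bar>h (x u) * path_weight V (u # w # ws) x\<bar> \<le> c"
      if "x \<in> space (Pi\<^sub>M (insert u ?J) (\<lambda>_. unit_borel))" for x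
    proof -
      have "x u \<in> space unit_borel"
        using PiE_mem[OF that[unfolded space_PiM], of u] by simp
      then have "\<bar>h (x u)\<bar> \<le> c"
        by (rule Cons.prems(3))
      then show ?thesis
        using path_weight_bounds[of "u # w # ws" x] unfolding abs_mult
        by (metis abs_ge_zero abs_of_nonneg mult_left_le order_trans)
    qed
    then show "AE x in Pi\<^sub>M (insert u ?J) (\<lambda>_. unit_borel). norm (h (x u) * path_weight V (u # w # ws) x) \<le> c"
      by (intro AE_I2) simp
  qed measurable
  then have "(\<integral>x. h (x u) * path_weight V (u # w # ws) x \<partial>Pi\<^sub>M (insert u ?J) (\<lambda>_. unit_borel)) =
      (\<integral>x. (\<integral>y. h ((x(u := y)) u) * path_weight V (u # w # ws) (x(u := y)) \<partial>unit_borel)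
        \<partial>Pi\<^sub>M ?J (\<lambda>_. unit_borel))"
    using u by (intro product_integral_insert) auto
  also have "\<dots> = (\<integral>x. kernel_int V h (x w) * path_weight V (w # ws) x \<partial>Pi\<^sub>M ?J (\<lambda>_. unit_borel))"
  proof (intro Bochner_Integration.integral_cong refl)
    fix x
    have "path_weight V (w # ws) (x(u := y)) = path_weight V (w # ws) x" for y
      using u by (intro path_weight_cong) auto
    \<comment> \<open>The edge at \<open>u\<close> contributes \<open>V (y, x w)\<close>; symmetry
      turns it into \<open>V (x w, y)\<close>, the form integrated by
      \<open>kernel_int\<close>.\<close>
    then have eq: "h ((x(u := y)) u) * path_weight V (u # w # ws) (x(u := y)) =
        V (x w, y) * h y * path_weight V (w # ws) x" for y
      using u by (simp add: borel_version_sym[OF WV, of y])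
    show "(\<integral>y. h ((x(u := y)) u) * path_weight V (u # w # ws) (x(u := y)) \<partial>unit_borel) =
        kernel_int V h (x w) * path_weight V (w # ws) x"
      unfolding eq kernel_int_def by simp
  qed
  also have "\<dots> = integral\<^sup>L unit_borel ((kernel_int V ^^ length ws) (kernel_int V h))"
  proof (rule Cons.IH)
    \<comment> \<open>The same \<open>c\<close> bounds the new function, since \<open>V\<close> is
      at most 1 and the measure has total mass 1.\<close>
    fix y assume "y \<in> space unit_borel"
    then have "\<bar>kernel_int V h y\<bar> \<le> integral\<^sup>L unit_borel (\<lambda>y. \<bar>h y\<bar>)"
      by (rule abs_kernel_int_le[OF WV hi])
    also have "\<dots> \<le> integral\<^sup>L unit_borel (\<lambda>y. c)"
      using hi Cons.prems(3) by (intro integral_mono) auto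
    finally show "\<bar>kernel_int V h y\<bar> \<le> c"
      by (simp add: measure_restrict_space)
  qed (use Cons.prems(1) kernel_int_measurable[OF WV Cons.prems(2)] in auto)
  finally show ?case
    by (simp add: funpow_swap1)
qed

lemma hom_density_path:
  assumes W: "graphon W" and vs: "distinct vs" "vs \<noteq> []"
  shows "hom_density (path_graph vs) W = inner ((graphon_op W ^^ (length vs - 1)) one_L2) one_L2"
proof -
  let ?P = "Pi\<^sub>M (set vs) (\<lambda>_. unit_borel)"
  obtain N where N: "N \<in> sets (unit_borel \<Otimes>\<^sub>M unit_borel)"
      "AE x in unit_borel. AE y in unit_borel. (x, y) \<notin> N"
      "\<And>x y. x \<in> {0..1} \<Longrightarrow> y \<in> {0..1} \<Longrightarrow> (x, y) \<notin> N \<Longrightarrow> case_prod W (x, y) = V (x, y)"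
    using WV unfolding borel_version_def prod.case by blast
  have "AE x in ?P. path_weight (case_prod W) vs x = path_weight V vs x"
    by (rule AE_path_weight[of N "case_prod W" V, OF N(3,1,2)]) (use vs in auto)
  then have ae: "AE x in ?P. (\<Prod>e\<in>snd (path_graph vs). edge_value W x e) = path_weight V vs x"
    using AE_space
  proof eventually_elim
    case (elim x)
    have "x v \<in> {0..1}" if "v \<in> set vs" for v
      using PiE_mem[OF elim(2)[unfolded space_PiM] that] by (simp add: space_restrict_space)
    then show ?case
      using elim(1) by (simp add: prod_edge_value_path[OF W vs(1)])
  qed
  obtain u us where us: "vs = u # us"
    using vs(2) by (cases vs) auto
  have "hom_density (path_graph vs) W = integral\<^sup>L (completion ?P) (\<lambda>x. \<Prod>e\<in>snd (path_graph vs). edge_value W x e)"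
    by (simp add: hom_density_def path_graph_def)
  \<comment> \<open>The density integrates over the completed product; its integrand agrees almost
    everywhere with a Borel function.\<close>
  also have "\<dots> = integral\<^sup>L ?P (path_weight V vs)"
    by (rule integral_completion_AE[OF path_weight_measurable ae]) simp
  also have "\<dots> = integral\<^sup>L unit_borel ((kernel_int V ^^ length us) (\<lambda>_. 1))"
    using integral_path_weight[of u us "\<lambda>_. 1" 1] vs(1) by (simp add: us)
  also have "\<dots> = inner ((graphon_op W ^^ (length vs - 1)) one_L2) one_L2"
    by (simp add: us graphon_op_moment[OF WV W])
  finally show ?thesis .
qed

end

lemma path_densities_eq_iff:
  assumes U: "graphon U" and W: "graphon W"
  shows "(\<forall>P :: nat graph. is_path P \<longrightarrow> hom_density P U = hom_density P W) \<longleftrightarrow>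
    (\<forall>n. inner ((graphon_op U ^^ n) one_L2) one_L2 = inner ((graphon_op W ^^ n) one_L2) one_L2)"
proof -
  obtain V where V: "borel_version U V"
    using ex_borel_version[OF U] .
  obtain V' where V': "borel_version W V'"
    using ex_borel_version[OF W] .
  have "(\<forall>P :: nat graph. is_path P \<longrightarrow> hom_density P U = hom_density P W) \<longleftrightarrow>
      (\<forall>vs :: nat list. vs \<noteq> [] \<longrightarrow> distinct vs \<longrightarrow>
        hom_density (path_graph vs) U = hom_density (path_graph vs) W)"
    unfolding is_path_def by blast
  also have "\<dots> \<longleftrightarrow>
      (\<forall>vs :: nat list. vs \<noteq> [] \<longrightarrow> distinct vs \<longrightarrow>
        inner ((graphon_op U ^^ (length vs - 1)) one_L2) one_L2 =
        inner ((graphon_op W ^^ (length vs - 1)) one_L2) one_L2)"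
    by (simp only: hom_density_path[OF V U] hom_density_path[OF V' W] not_False_eq_True cong: imp_cong)
  also have "\<dots> \<longleftrightarrow>
      (\<forall>n. inner ((graphon_op U ^^ n) one_L2) one_L2 = inner ((graphon_op W ^^ n) one_L2) one_L2)"
  proof (intro iffI allI)
    fix n
    assume "\<forall>vs :: nat list. vs \<noteq> [] \<longrightarrow> distinct vs \<longrightarrow>
        inner ((graphon_op U ^^ (length vs - 1)) one_L2) one_L2 =
        inner ((graphon_op W ^^ (length vs - 1)) one_L2) one_L2"
    \<comment> \<open>This list has \<open>n + 1\<close> distinct vertices, so its path has
      \<open>n\<close> edges and realises the moment of order \<open>n\<close>.\<close>
    from this[rule_format, of "[0..<Suc n]"]
    show "inner ((graphon_op U ^^ n) one_L2) one_L2 = inner ((graphon_op W ^^ n) one_L2) one_L2"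
      by simp
  qed simp
  finally show ?thesis .
qed

theorem theorem22:
  fixes U W :: "real \<Rightarrow> real \<Rightarrow> real"
  assumes "graphon U" and "graphon W"
  shows "(\<exists>S. signed_markov S \<and> graphon_op U \<circ> S = S \<circ> graphon_op W) \<longleftrightarrow>
         (\<forall>P :: nat graph. is_path P \<longrightarrow> hom_density P U = hom_density P W)"
proof -
  obtain V where V: "borel_version U V"
    using ex_borel_version[OF assms(1)] .
  obtain V' where V': "borel_version W V'"
    using ex_borel_version[OF assms(2)] .
  note self_adjoint = graphon_op_self_adjoint[OF V assms(1)] graphon_op_self_adjoint[OF V' assms(2)]
  have "(\<exists>S. signed_markov S \<and> graphon_op U \<circ> S = S \<circ> graphon_op W) \<longleftrightarrow>
    (\<forall>n. inner ((graphon_op U ^^ n) one_L2) one_L2 = inner ((graphon_op W ^^ n) one_L2) one_L2)"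
  proof (intro iffI allI)
    fix n
    assume "\<exists>S. signed_markov S \<and> graphon_op U \<circ> S = S \<circ> graphon_op W"
    then obtain S where S: "bounded_linear S" "\<And>f. norm (S f) \<le> norm f" "S one_L2 = one_L2"
        and comm: "\<And>f. graphon_op U (S f) = S (graphon_op W f)"
      by (auto simp: signed_markov_def fun_eq_iff)
    have "(graphon_op U ^^ n) (S f) = S ((graphon_op W ^^ n) f)" for f
      by (induction n) (simp_all add: comm)
    then have "inner ((graphon_op U ^^ n) one_L2) one_L2 = inner (S ((graphon_op W ^^ n) one_L2)) (S one_L2)"
      by (metis S(3))
    \<comment> \<open>The contraction fixes the constant one, hence preserves its norm, and so
      preserves all inner products with it.\<close>
    also have "\<dots> = inner ((graphon_op W ^^ n) one_L2) one_L2"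
      using S by (intro contraction_inner) (auto simp: bounded_linear.linear)
    finally show "inner ((graphon_op U ^^ n) one_L2) one_L2 = inner ((graphon_op W ^^ n) one_L2) one_L2" .
  next
    assume "\<forall>n. inner ((graphon_op U ^^ n) one_L2) one_L2 = inner ((graphon_op W ^^ n) one_L2) one_L2"
    then have moments:
      "inner ((graphon_op W ^^ n) one_L2) one_L2 = inner ((graphon_op U ^^ n) one_L2) one_L2" for n
      by simp
    obtain S where "bounded_linear S" "\<And>f. norm (S f) \<le> norm f" "S one_L2 = one_L2"
        "adjoint S one_L2 = one_L2" "graphon_op U \<circ> S = S \<circ> graphon_op W"
      \<comment> \<open>The operator of \<open>W\<close> acts on the source side and that of
        \<open>U\<close> on the target side, whence the swapped order; both vectors are the constant
        one.\<close>
      using hilbert_intertwiner[OF self_adjoint(2,1) bounded_linear_graphon_op[OF V assms(1)] moments]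
      by blast
    then show "\<exists>S. signed_markov S \<and> graphon_op U \<circ> S = S \<circ> graphon_op W"
      unfolding signed_markov_def by blast
  qed
  then show ?thesis
    using path_densities_eq_iff[OF assms] by simp
qed

end
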